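(* For $n\ge1$ let $P_{n}^{(\mathrm{lpk},\mathrm{ipk})}(s,t)=\sum_{\pi\in\mathfrak{S}_{n}}s^{\mathrm{lpk}(\pi)}t^{\mathrm{ipk}(\pi)+1}$. Then: (a) As formal power series, \[ \frac{1}{(1-s)(1-t)}+\frac{1}{2}\sum_{n=1}^{\infty}\frac{(1+s)^{n}(1+t)^{n+1}}{((1-s)(1-t))^{n+1}}P_{n}^{(\mathrm{lpk},\mathrm{ipk})}\left(\frac{4s}{(1+s)^{2}},\frac{4t}{(1+t)^{2}}\right)x^{n} =\sum_{i,j=0}^{\infty}\left(\frac{1+x}{1-x}\right)^{2ij+j}s^{i}t^{j}. \] (b) For all $n\geq1$, \[ \frac{(1+s)^{n}(1+t)^{n+1}}{((1-s)(1-t))^{n+1}}P_{n}^{(\mathrm{lpk},\mathrm{ipk})}\left(\frac{4s}{(1+s)^{2}},\frac{4t}{(1+t)^{2}}\right) =2\sum_{i,j=0}^{\infty}\sum_{k=0}^{n}\binom{2ij+j}{k}\binom{2ij+j+n-k-1}{n-k}s^{i}t^{j}. \] (c) For all $n\geq1$, \[ \frac{(1+s)^{n}(1+t)^{n+1}}{((1-s)(1-t))^{n+1}}P_{n}^{(\mathrm{lpk},\mathrm{ipk})}\left(\frac{4s}{(1+s)^{2}},\frac{4t}{(1+t)^{2}}\right) =\frac{1}{n!}\sum_{k=0}^n 2^{k+1} d(n,k)\frac{B_{k}(s)A_{k}(t)}{(1-s)^{k+1}(1-t)^{k+1}}. \]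
   Context: $\mathfrak{S}_n$ is the symmetric group on $[n]$. For $\pi\in\mathfrak{S}_n$: $i\in[n-1]$ is a descent if $\pi(i)>\pi(i+1)$, $\mathrm{des}(\pi)$ the number of descents; $i$ with $2\le i\le n-1$ is a peak if $\pi(i-1)<\pi(i)>\pi(i+1)$, $\mathrm{pk}(\pi)$ the number of peaks, $\mathrm{ipk}(\pi)=\mathrm{pk}(\pi^{-1})$; $i\in[n-1]$ is a left peak if $i$ is a peak or if $i=1$ and $\pi(1)>\pi(2)$, $\mathrm{lpk}(\pi)$ the number of left peaks. $A_n(t)=\sum_{\pi\in\mathfrak{S}_n}t^{\mathrm{des}(\pi)+1}$ for $n\ge1$, $A_0=1$. The type B Eulerian polynomials $B_n(t)$ are defined by $\frac{B_{n}(t)}{(1-t)^{n+1}}=\sum_{k\ge0}(2k+1)^{n}t^{k}$. $d(n,k)$ is the number of permutations in $\mathfrak{S}_n$ with exactly $k$ cycles, all of odd length (with $d(0,0)=1$). *)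

theory Defs
  imports
    "HOL-Computational_Algebra.Polynomial_FPS"
    "HOL-Combinatorics.Orbits"
begin

definition des :: "nat \<Rightarrow> (nat \<Rightarrow> nat) \<Rightarrow> nat" where
  "des n \<pi> = card {i \<in> {1..n - 1}. \<pi> i > \<pi> (i + 1)}"

definition is_peak :: "nat \<Rightarrow> (nat \<Rightarrow> nat) \<Rightarrow> nat \<Rightarrow> bool" where
  "is_peak n \<pi> i \<longleftrightarrow> 2 \<le> i \<and> i \<le> n - 1 \<and> \<pi> (i - 1) < \<pi> i \<and> \<pi> i > \<pi> (i + 1)"

definition pk :: "nat \<Rightarrow> (nat \<Rightarrow> nat) \<Rightarrow> nat" where
  "pk n \<pi> = card {i. is_peak n \<pi> i}"

definition ipk :: "nat \<Rightarrow> (nat \<Rightarrow> nat) \<Rightarrow> nat" where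
  "ipk n \<pi> = pk n (inv \<pi>)"

definition lpk :: "nat \<Rightarrow> (nat \<Rightarrow> nat) \<Rightarrow> nat" where
  "lpk n \<pi> = card {i \<in> {1..n - 1}. is_peak n \<pi> i \<or> i = 1 \<and> \<pi> 1 > \<pi> 2}"

text \<open>
  The polynomials \<open>P\<^sub>n\<close> and \<open>A\<^sub>n\<close> are given by their values in an arbitrary commutative
  semiring, so that formal power series can be substituted for their variables.
\<close>

definition P_lpk_ipk :: "nat \<Rightarrow> 'a::comm_semiring_1 \<Rightarrow> 'a \<Rightarrow> 'a" where
  "P_lpk_ipk n s t = (\<Sum>\<pi> | \<pi> permutes {1..n}. s ^ lpk n \<pi> * t ^ (ipk n \<pi> + 1))"

definition eulerian_A :: "nat \<Rightarrow> 'a::comm_semiring_1 \<Rightarrow> 'a" where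
  "eulerian_A n t = (if n = 0 then 1 else (\<Sum>\<pi> | \<pi> permutes {1..n}. t ^ (des n \<pi> + 1)))"

definition eulerian_B :: "nat \<Rightarrow> rat poly" where
  "eulerian_B n =
     (THE p. fps_of_poly p / (1 - fps_X) ^ (n + 1) = Abs_fps (\<lambda>k. (2 * of_nat k + 1) ^ n))"

text \<open>The definite description above is well-defined:\<close>

lemma eulerian_B_poly_exists:
  "\<exists>p :: rat poly. fps_of_poly p = Abs_fps (\<lambda>k. (2 * of_nat k + 1) ^ n) * (1 - fps_X) ^ (n + 1)"
proof (induction n)
  case 0
  have "Abs_fps (\<lambda>k. 1 :: rat) * (1 - fps_X) = 1"
    by (rule fps_ext) (auto simp: algebra_simps)
  then show ?case
    by (intro exI[of _ 1]) simp
next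
  case (Suc n)
  define F :: "nat \<Rightarrow> rat fps" where "F = (\<lambda>n. Abs_fps (\<lambda>k. (2 * of_nat k + 1) ^ n))"
  obtain p :: "rat poly" where p: "fps_of_poly p = F n * (1 - fps_X) ^ (n + 1)"
    using Suc.IH unfolding F_def by blast
  have F_Suc: "F (Suc n) = F n + 2 * fps_X * fps_deriv (F n)"
  proof (rule fps_ext)
    fix k
    show "fps_nth (F (Suc n)) k = fps_nth (F n + 2 * fps_X * fps_deriv (F n)) k"
      by (cases k) (simp_all add: F_def mult.assoc numeral_fps_const distrib_right)
  qed
  define u c :: "rat fps" where "u = 1 - fps_X" and "c = of_nat (n + 1)"
  have p: "fps_of_poly p = F n * u ^ (n + 1)"
    using p by (simp add: u_def)
  have "fps_deriv (u ^ (n + 1)) = - (c * u ^ n)"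
    by (simp only: fps_deriv_power') (simp add: u_def c_def algebra_simps)
  then have D: "fps_deriv (fps_of_poly p) = fps_deriv (F n) * u ^ (n + 1) - c * F n * u ^ n"
    unfolding p fps_deriv_mult by (simp add: algebra_simps)
  have E: "u * fps_deriv (fps_of_poly p) + c * fps_of_poly p = fps_deriv (F n) * u ^ (n + 2)"
    unfolding D by (simp add: p algebra_simps)
  have "F (Suc n) * u ^ (Suc n + 1) =
      u * fps_of_poly p + 2 * fps_X * (u * fps_deriv (fps_of_poly p) + c * fps_of_poly p)"
    unfolding E by (simp add: F_Suc p algebra_simps)
  also have "\<dots> = fps_of_poly ([:1, -1:] * p +
      [:0, 2:] * ([:1, -1:] * pderiv p + [:of_nat (n + 1):] * p))"
  proof -
    have "fps_of_poly [:1, -1:] = u" "fps_of_poly [:0, 2 :: rat:] = 2 * fps_X"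
      "fps_of_poly [:of_nat (n + 1):] = c"
      by (simp_all only: fps_of_poly_pCons fps_of_poly_const u_def c_def fps_of_nat)
        (simp_all add: fps_const_neg[symmetric] numeral_fps_const)
    then show ?thesis
      by (simp only: fps_of_poly_add fps_of_poly_mult fps_of_poly_pderiv)
  qed
  finally show ?case
    unfolding F_def u_def by (intro exI) (rule sym)
qed

lemma eulerian_B_gf:
  "fps_of_poly (eulerian_B n) / (1 - fps_X) ^ (n + 1) = Abs_fps (\<lambda>k. (2 * of_nat k + 1) ^ n)"
proof -
  have unit: "fps_nth ((1 - fps_X :: rat fps) ^ (n + 1)) 0 \<noteq> 0"
    by (simp add: fps_nth_power_0)
  have iff: "f / u = g \<longleftrightarrow> f = g * u" if "fps_nth u 0 \<noteq> 0" for f g u :: "rat fps"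
  proof -
    have "inverse u * u = 1"
      using that by (rule inverse_mult_eq_1)
    then show ?thesis
      unfolding fps_divide_unit[OF that] by (auto simp: mult.assoc mult.commute[of u])
  qed
  have "\<exists>!p :: rat poly. fps_of_poly p / (1 - fps_X) ^ (n + 1) = Abs_fps (\<lambda>k. (2 * of_nat k + 1) ^ n)"
    unfolding iff[OF unit] using eulerian_B_poly_exists[of n]
    by (auto simp: fps_of_poly_eq_iff[symmetric])
  from theI'[OF this] show ?thesis
    unfolding eulerian_B_def .
qed

text \<open>The cycles of a permutation, fixed points included, are identified with its orbits.\<close>

definition d_odd :: "nat \<Rightarrow> nat \<Rightarrow> nat" where
  "d_odd n k = card {\<pi>. \<pi> permutes {1..n} \<and> card (orbit \<pi> ` {1..n}) = k \<and>
                      (\<forall>C \<in> orbit \<pi> ` {1..n}. odd (card C))}"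

text \<open>
  The ring of formal power series in \<open>s\<close> and \<open>t\<close> over the rationals is rendered as
  \<^typ>\<open>rat fps fps\<close>, with \<open>s\<close> the inner and \<open>t\<close> the outer variable.  All denominators
  below are units of this ring, on which division of formal power series is the true one.
\<close>

abbreviation s_var :: "rat fps fps" where
  "s_var \<equiv> fps_const fps_X"

abbreviation t_var :: "rat fps fps" where
  "t_var \<equiv> fps_X"

text \<open>The formal double sum of \<open>c i j * s ^ i * t ^ j\<close> over all \<open>i\<close> and \<open>j\<close>.\<close>

definition st_series :: "(nat \<Rightarrow> nat \<Rightarrow> rat) \<Rightarrow> rat fps fps" where
  "st_series c = Abs_fps (\<lambda>j. Abs_fps (\<lambda>i. c i j))"

text \<open>
  A formal power series in \<open>x\<close> over this ring is an element of \<^typ>\<open>rat fps fps fps\<close>,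
  with \<open>x\<close> outermost; \<open>lhs_term n\<close> is the expression involving \<open>P\<^sub>n\<close> that is
  common to all three identities.
\<close>

definition lhs_term :: "nat \<Rightarrow> rat fps fps" where
  "lhs_term n =
     (1 + s_var) ^ n * (1 + t_var) ^ (n + 1) / ((1 - s_var) * (1 - t_var)) ^ (n + 1) *
     P_lpk_ipk n (4 * s_var / (1 + s_var)\<^sup>2) (4 * t_var / (1 + t_var)\<^sup>2)"

end

theory Submission
  imports Defs
begin

text \<open>
  Fix \<open>i\<close>, \<open>j\<close> and \<open>n \<ge> 1\<close>. For a permutation \<open>\<pi>\<close> let \<open>a\<^sub>\<pi>(i)\<close> be the number of its left enriched
  \<open>P\<close>-partitions into \<open>2i + 1\<close> signed letters, and \<open>b\<^sub>\<pi>(j)\<close> the number of enriched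
  \<open>P\<close>-partitions of its inverse into \<open>2j\<close> signed letters. Standardization of words over the second alphabet turns
  \<open>\<Sum>\<^sub>\<pi> a\<^sub>\<pi>(i) b\<^sub>\<pi>(j)\<close> into the number of sorted words of \<open>n\<close> signed pairs in which a pair may be
  repeated iff it is positive. Half of the \<open>2j(2i + 1)\<close> pairs are positive, so the sum is the
  coefficient of \<open>x\<^sup>n\<close> in \<open>((1 + x) / (1 - x)) ^ ((2i + 1) j)\<close>. On the other hand, building the
  partitions one letter at a time shows that the generating functions of \<open>a\<^sub>\<pi>\<close> and \<open>b\<^sub>\<pi>\<close> depend only
  on the numbers of left peaks of \<open>\<pi>\<close> and of peaks of its inverse; they are the factors of the summand
  of \<open>\<pi>\<close> on the left-hand side. This gives (a) and (b).

  For (c), the permutations with only odd cycles, weighted by \<open>(2m) ^ (number of cycles)\<close>, satisfy the same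
  recurrence in \<open>n\<close> as \<open>n!\<close> times the coefficients of \<open>((1 + x) / (1 - x)) ^ m\<close>, by removing two
  consecutive points from a cycle; with \<open>m = (2i + 1) j\<close> the powers \<open>(2i + 1)\<^sup>k\<close> and \<open>j\<^sup>k\<close> are the
  coefficients of the type B and type A Eulerian generating functions.
\<close>

section \<open>Enriched partitions and standardization of words\<close>

text \<open>
  \<open>R k a\<close> tells whether the letter \<open>a\<close> may occupy both of the positions \<open>k\<close> and \<open>k + 1\<close>;
  the letters lie in \<open>{lo..<hi}\<close>.
\<close>

definition chains :: "(nat \<Rightarrow> nat \<Rightarrow> bool) \<Rightarrow> nat \<Rightarrow> nat \<Rightarrow> nat \<Rightarrow> (nat \<Rightarrow> nat) set" where
  "chains R n lo hi = {f \<in> {1..n} \<rightarrow>\<^sub>E {lo..<hi}.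
     \<forall>k\<in>{1..<n}. f k < f (Suc k) \<or> f k = f (Suc k) \<and> R k (f k)}"

lemma finite_chains: "finite (chains R n lo hi)"
  unfolding chains_def by (rule finite_subset[OF _ finite_PiE[of "{1..n}" "\<lambda>_. {lo..<hi}"]]) auto

lemma chains_mono:
  assumes "f \<in> chains R n lo hi" "1 \<le> k" "k \<le> l" "l \<le> n"
  shows "f k \<le> f l"
  using assms(3,4)
proof (induction l rule: dec_induct)
  case (step m)
  then have "m \<in> {1..<n}" using assms(2) by auto
  then have "f m \<le> f (Suc m)" using assms(1) unfolding chains_def by fastforce
  with step show ?case by simp
qed simp

lemma chains_0 [simp]: "chains R 0 lo hi = {\<lambda>_. undefined}"
  by (auto simp: chains_def)

lemma chains_empty [simp]: "n \<ge> 1 \<Longrightarrow> chains R n lo lo = {}"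
  by (auto simp: chains_def PiE_eq_empty_iff)

lemma chains_Suc:
  assumes "lo \<le> v"
  shows "chains R (Suc n) lo (Suc v) = chains R (Suc n) lo v \<union>
    (\<lambda>g. g(Suc n := v)) ` chains R n lo (if R n v then Suc v else v)" (is "?L = ?A \<union> ?B")
proof (intro set_eqI iffI)
  fix f assume f: "f \<in> ?L"
  have mono: "f k \<le> f (Suc n)" if "k \<in> {1..Suc n}" for k
    using chains_mono[OF f, of k "Suc n"] that by auto
  show "f \<in> ?A \<union> ?B"
  proof (cases "f (Suc n) = v")
    case False
    have "f (Suc n) < Suc v" using f by (auto simp: chains_def PiE_iff)
    with False have "f (Suc n) < v" by simp
    then have "f k < v" if "k \<in> {1..Suc n}" for k using mono[OF that] by simp
    then have "f \<in> ?A" using f by (auto simp: chains_def PiE_iff)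
    then show ?thesis by blast
  next
    case True
    define g where "g = f(Suc n := undefined)"
    have less: "f k < v" if "\<not> R n v" "k \<in> {1..n}" for k
    proof -
      have "n \<in> {1..<Suc n}" using that by auto
      then have "f n < f (Suc n) \<or> f n = f (Suc n) \<and> R n (f n)"
        using f unfolding chains_def by blast
      with that True have "f n < v" by auto
      moreover have "f k \<le> f n" using chains_mono[OF f, of k n] that by auto
      ultimately show ?thesis by simp
    qed
    have "g \<in> chains R n lo (if R n v then Suc v else v)"
      using f less by (auto simp: chains_def PiE_iff g_def extensional_def)
    moreover have "f = g(Suc n := v)" by (simp add: g_def True fun_eq_iff)
    ultimately show ?thesis by blast
  qed
next
  fix f assume "f \<in> ?A \<union> ?B"
  then show "f \<in> ?L"
  proof
    assume "f \<in> ?A" then show ?thesis by (auto simp: chains_def PiE_iff)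
  next
    assume "f \<in> ?B"
    then obtain g where g: "g \<in> chains R n lo (if R n v then Suc v else v)" "f = g(Suc n := v)"
      by blast
    have fg: "f k = g k" if "k \<in> {1..n}" for k using g(2) that by auto
    have range: "lo \<le> g k \<and> g k < (if R n v then Suc v else v)" if "k \<in> {1..n}" for k
      using g(1) that unfolding chains_def PiE_iff by auto
    have "f k < f (Suc k) \<or> f k = f (Suc k) \<and> R k (f k)" if k: "k \<in> {1..<Suc n}" for k
    proof (cases "k = n")
      case True
      then show ?thesis using range[of n] k g(2) by (cases "g n = v") (auto split: if_splits)
    next
      case False
      then have "k \<in> {1..<n}" using k by auto
      moreover from this have "f k = g k" "f (Suc k) = g (Suc k)" using fg by auto
      ultimately show ?thesis using g(1) unfolding chains_def by auto
    qed
    moreover have "f \<in> {1..Suc n} \<rightarrow>\<^sub>E {lo..<Suc v}"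
    proof (rule PiE_I)
      fix k assume "k \<in> {1..Suc n}"
      then show "f k \<in> {lo..<Suc v}"
        using range[of k] g(2) assms by (cases "k = Suc n") (auto split: if_splits)
    next
      fix k assume "k \<notin> {1..Suc n}"
      then show "f k = undefined"
        using g by (auto simp: chains_def PiE_iff extensional_def)
    qed
    ultimately show ?thesis unfolding chains_def by blast
  qed
qed

lemma card_chains_Suc:
  assumes "lo \<le> v"
  shows "card (chains R (Suc n) lo (Suc v)) =
    card (chains R (Suc n) lo v) + card (chains R n lo (if R n v then Suc v else v))"
proof -
  have "chains R (Suc n) lo v \<inter> (\<lambda>g. g(Suc n := v)) ` chains R n lo (if R n v then Suc v else v) = {}"
  proof -
    have "f (Suc n) \<noteq> v" if "f \<in> chains R (Suc n) lo v" for f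
      using that unfolding chains_def PiE_iff by force
    then show ?thesis by fastforce
  qed
  moreover have "inj_on (\<lambda>g. g(Suc n := v)) (chains R n lo u)" for u
  proof (rule inj_onI)
    fix g h assume gh: "g \<in> chains R n lo u" "h \<in> chains R n lo u" "g(Suc n := v) = h(Suc n := v)"
    show "g = h"
    proof
      fix k
      show "g k = h k"
      proof (cases "k = Suc n")
        case True
        then show ?thesis using gh(1,2) by (simp add: chains_def PiE_iff extensional_def)
      next
        case False
        then show ?thesis using fun_cong[OF gh(3), of k] by simp
      qed
    qed
  qed
  ultimately show ?thesis
    unfolding chains_Suc[OF assms]
    by (subst card_Un_disjoint) (auto simp: finite_chains card_image)
qed

section \<open>Ascents, signed order of positions and standardization\<close>

definition ascents :: "nat \<Rightarrow> (nat \<Rightarrow> nat) \<Rightarrow> nat set" where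
  "ascents n \<sigma> = {k \<in> {1..<n}. \<sigma> k < \<sigma> (Suc k)}"

text \<open>The ascents of the standardization of \<open>w\<close>, read off from its letters: equal
  positive letters are numbered from left to right, equal negative ones from right to left.\<close>

definition signed_ascents :: "(nat \<Rightarrow> bool) \<Rightarrow> nat \<Rightarrow> (nat \<Rightarrow> nat) \<Rightarrow> nat set" where
  "signed_ascents \<epsilon> n w = {k \<in> {1..<n}. w k < w (Suc k) \<or> w k = w (Suc k) \<and> \<epsilon> (w k)}"

text \<open>
  The enriched \<open>P\<close>-partitions of a chain labelled with ascent set \<open>S\<close>: letters satisfying \<open>\<epsilon>\<close> count
  as positive, the others as negative. With \<open>\<epsilon> = even\<close>, the alphabet \<open>{1..<2 * j + 1}\<close> stands for
  \<open>-1 < 1 < -2 < 2 < \<dots> < -j < j\<close>, and \<open>{0..<2 * i + 1}\<close> for the left enriched alphabet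
  \<open>0 < -1 < 1 < \<dots> < -i < i\<close>.
\<close>

definition enriched :: "(nat \<Rightarrow> bool) \<Rightarrow> nat set \<Rightarrow> nat \<Rightarrow> nat \<Rightarrow> nat \<Rightarrow> (nat \<Rightarrow> nat) set" where
  "enriched \<epsilon> S = chains (\<lambda>k a. \<epsilon> a \<longleftrightarrow> k \<in> S)"

definition signed_less :: "(nat \<Rightarrow> bool) \<Rightarrow> (nat \<Rightarrow> nat) \<Rightarrow> nat \<Rightarrow> nat \<Rightarrow> bool" where
  "signed_less \<epsilon> w k l \<longleftrightarrow> w k < w l \<or> w k = w l \<and> (if \<epsilon> (w k) then k < l else l < k)"

lemma signed_less_trans:
  "signed_less \<epsilon> w k l \<Longrightarrow> signed_less \<epsilon> w l m \<Longrightarrow> signed_less \<epsilon> w k m"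
  unfolding signed_less_def by (metis less_trans)

lemma signed_less_asym: "signed_less \<epsilon> w k l \<Longrightarrow> \<not> signed_less \<epsilon> w l k"
  unfolding signed_less_def by (metis less_asym less_irrefl)

lemma signed_less_total: "k \<noteq> l \<Longrightarrow> signed_less \<epsilon> w k l \<or> signed_less \<epsilon> w l k"
  unfolding signed_less_def by (metis linorder_neqE_nat)

text \<open>For adjacent values \<open>p\<close> and \<open>Suc p\<close> the chain condition is one
  signed comparison of the positions holding them, and transitivity extends it to all pairs. The
  right-hand side is what forces the word \<open>g \<circ> \<pi>\<close> to have standardization
  \<pi>.\<close>

lemma enriched_iff:
  assumes "\<pi> permutes {1..n}"
  shows "g \<in> enriched \<epsilon> (ascents n (inv \<pi>)) n lo hi \<longleftrightarrow>
    g \<in> {1..n} \<rightarrow>\<^sub>E {lo..<hi} \<and>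
    (\<forall>k\<in>{1..n}. \<forall>l\<in>{1..n}. \<pi> k < \<pi> l \<longrightarrow> signed_less \<epsilon> (g \<circ> \<pi>) k l)" (is "?L \<longleftrightarrow> ?R")
proof
  assume L: ?L
  have adj: "signed_less \<epsilon> (g \<circ> \<pi>) (inv \<pi> p) (inv \<pi> (Suc p))" if "p \<in> {1..<n}" for p
  proof -
    have "g p < g (Suc p) \<or> g p = g (Suc p) \<and> (\<epsilon> (g p) \<longleftrightarrow> inv \<pi> p < inv \<pi> (Suc p))"
      using L that unfolding enriched_def chains_def ascents_def by auto
    moreover have "inv \<pi> p \<noteq> inv \<pi> (Suc p)"
      using permutes_inj[OF permutes_inv[OF assms]] by (metis injD n_not_Suc_n)
    ultimately show ?thesis
      using assms by (auto simp: signed_less_def permutes_inverses)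
  qed
  have far: "signed_less \<epsilon> (g \<circ> \<pi>) (inv \<pi> p) (inv \<pi> q)" if "Suc p \<le> q" "1 \<le> p" "q \<le> n" for p q
    using that(1,3)
  proof (induction q rule: dec_induct)
    case base
    show ?case by (rule adj) (use base that(2) in simp)
  next
    case (step q)
    have "q \<in> {1..<n}" using step.hyps step.prems \<open>1 \<le> p\<close> by simp
    then have "signed_less \<epsilon> (g \<circ> \<pi>) (inv \<pi> q) (inv \<pi> (Suc q))" by (rule adj)
    moreover have "signed_less \<epsilon> (g \<circ> \<pi>) (inv \<pi> p) (inv \<pi> q)"
      using step.prems by (intro step.IH) simp
    ultimately show ?case by (blast intro: signed_less_trans[of \<epsilon> "g \<circ> \<pi>" "inv \<pi> p" "inv \<pi> q"])
  qed
  have "signed_less \<epsilon> (g \<circ> \<pi>) k l" if "k \<in> {1..n}" "l \<in> {1..n}" "\<pi> k < \<pi> l" for k l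
  proof -
    have "\<pi> k \<in> {1..n}" "\<pi> l \<in> {1..n}" using that permutes_in_image[OF assms] by blast+
    then show ?thesis
      using far[of "\<pi> k" "\<pi> l"] that assms by (simp add: permutes_inverses)
  qed
  moreover have "g \<in> {1..n} \<rightarrow>\<^sub>E {lo..<hi}" using L by (simp add: enriched_def chains_def)
  ultimately show ?R by blast
next
  assume R: ?R
  have "g p < g (Suc p) \<or> g p = g (Suc p) \<and> (\<epsilon> (g p) \<longleftrightarrow> p \<in> ascents n (inv \<pi>))"
    if p: "p \<in> {1..<n}" for p
  proof -
    have mem: "inv \<pi> p \<in> {1..n}" "inv \<pi> (Suc p) \<in> {1..n}"
      using p permutes_in_image[OF permutes_inv[OF assms]] by auto
    have "\<pi> (inv \<pi> p) < \<pi> (inv \<pi> (Suc p))" using assms by (simp add: permutes_inverses)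
    with R mem have "signed_less \<epsilon> (g \<circ> \<pi>) (inv \<pi> p) (inv \<pi> (Suc p))" by blast
    then show ?thesis
      using assms p by (auto simp: signed_less_def permutes_inverses ascents_def split: if_splits)
  qed
  then show ?L using R unfolding enriched_def chains_def by blast
qed

definition std :: "(nat \<Rightarrow> bool) \<Rightarrow> nat \<Rightarrow> (nat \<Rightarrow> nat) \<Rightarrow> nat \<Rightarrow> nat" where
  "std \<epsilon> n w k = (if k \<in> {1..n} then Suc (card {l \<in> {1..n}. signed_less \<epsilon> w l k}) else k)"

lemma std_less_iff:
  assumes "k \<in> {1..n}" "l \<in> {1..n}"
  shows "std \<epsilon> n w k < std \<epsilon> n w l \<longleftrightarrow> signed_less \<epsilon> w k l"
proof -
  have *: "std \<epsilon> n w k < std \<epsilon> n w l"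
    if "signed_less \<epsilon> w k l" "k \<in> {1..n}" "l \<in> {1..n}" for k l
  proof -
    have "{m \<in> {1..n}. signed_less \<epsilon> w m k} \<subset> {m \<in> {1..n}. signed_less \<epsilon> w m l}"
      using that signed_less_trans[of \<epsilon> w _ k l] signed_less_asym[of \<epsilon> w k k] by blast
    then show ?thesis using that by (simp add: std_def psubset_card_mono)
  qed
  show ?thesis
    using *[of k l] *[of l k] assms signed_less_total[of k l \<epsilon> w] signed_less_asym[of \<epsilon> w k k]
    by (metis less_asym less_irrefl)
qed

lemma std_permutes: "std \<epsilon> n w permutes {1..n}"
proof (rule bij_imp_permutes)
  have "std \<epsilon> n w k \<in> {1..n}" if "k \<in> {1..n}" for k
  proof -
    have "{l \<in> {1..n}. signed_less \<epsilon> w l k} \<subset> {1..n}"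
      using that signed_less_asym[of \<epsilon> w k k] by blast
    then have "card {l \<in> {1..n}. signed_less \<epsilon> w l k} < n"
      using psubset_card_mono[OF finite_atLeastAtMost] by (metis card_atLeastAtMost diff_Suc_1)
    then show ?thesis using that by (simp add: std_def)
  qed
  then have "std \<epsilon> n w ` {1..n} \<subseteq> {1..n}" by blast
  moreover have "inj_on (std \<epsilon> n w) {1..n}"
    by (rule inj_onI) (metis less_irrefl signed_less_total std_less_iff)
  ultimately show "bij_betw (std \<epsilon> n w) {1..n} {1..n}"
    by (simp add: bij_betw_def endo_inj_surj)
qed (auto simp: std_def)

text \<open>A permutation is determined by the relative order of its values: \<open>\<pi> k\<close>
  is one more than the number of smaller values, and these sit at the positions before
  \<open>k\<close> in the signed order.\<close>

lemma permutes_eq_std: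
  assumes "\<pi> permutes {1..n}"
    and "\<And>k l. k \<in> {1..n} \<Longrightarrow> l \<in> {1..n} \<Longrightarrow> \<pi> k < \<pi> l \<Longrightarrow> signed_less \<epsilon> w k l"
  shows "\<pi> = std \<epsilon> n w"
proof
  fix k
  show "\<pi> k = std \<epsilon> n w k"
  proof (cases "k \<in> {1..n}")
    case True
    have "signed_less \<epsilon> w l k \<longleftrightarrow> \<pi> l < \<pi> k" if l: "l \<in> {1..n}" for l
    proof (cases "l = k")
      case False
      then have "\<pi> l \<noteq> \<pi> k" using permutes_inj[OF assms(1)] by (auto dest: injD)
      then show ?thesis
        using assms(2)[OF l True] assms(2)[OF True l] signed_less_asym by (meson nat_neq_iff)
    qed (use signed_less_asym in blast)
    then have "card {l \<in> {1..n}. signed_less \<epsilon> w l k} = card {l \<in> {1..n}. \<pi> l < \<pi> k}"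
      by (intro arg_cong[where f = card]) blast
    also have "\<dots> = card (\<pi> ` {l \<in> {1..n}. \<pi> l < \<pi> k})"
      using permutes_inj[OF assms(1)] by (intro card_image[symmetric]) (auto intro: inj_on_subset)
    also have "\<pi> ` {l \<in> {1..n}. \<pi> l < \<pi> k} = {p \<in> \<pi> ` {1..n}. p < \<pi> k}" by blast
    also have "\<dots> = {1..<\<pi> k}"
      using permutes_in_image[OF assms(1), of k] True
      unfolding permutes_image[OF assms(1)] by auto
    finally show ?thesis
      using permutes_in_image[OF assms(1), of k] True by (simp add: std_def)
  next
    case False
    then show ?thesis using permutes_not_in[OF assms(1) False] unfolding std_def by (simp only: if_False)
  qed
qed

text \<open>A word \<open>w\<close> corresponds to the pair of its standardization \<open>\<pi>\<close> and the sorted word \<open>w \<circ> inv \<pi>\<close>.\<close>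

lemma standardization:
  fixes \<Phi> :: "nat set \<Rightarrow> nat"
  shows "(\<Sum>\<pi> | \<pi> permutes {1..n}. card (enriched \<epsilon> (ascents n (inv \<pi>)) n lo hi) * \<Phi> (ascents n \<pi>)) =
    (\<Sum>w\<in>{1..n} \<rightarrow>\<^sub>E {lo..<hi}. \<Phi> (signed_ascents \<epsilon> n w))"
proof -
  let ?E = "\<lambda>\<pi>. enriched \<epsilon> (ascents n (inv \<pi>)) n lo hi"
  let ?w = "\<lambda>\<pi> g. restrict (g \<circ> \<pi>) {1..n}"
  have less_cong: "signed_less \<epsilon> (?w \<pi> g) k l \<longleftrightarrow> signed_less \<epsilon> (g \<circ> \<pi>) k l"
    if "k \<in> {1..n}" "l \<in> {1..n}" for \<pi> g k l using that by (simp add: signed_less_def)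
  have std: "std \<epsilon> n (?w \<pi> g) = \<pi>" if "\<pi> permutes {1..n}" "g \<in> ?E \<pi>" for \<pi> g
  proof (rule sym, rule permutes_eq_std[OF that(1)])
    fix k l assume "k \<in> {1..n}" "l \<in> {1..n}" "\<pi> k < \<pi> l"
    then show "signed_less \<epsilon> (?w \<pi> g) k l"
      using that(2) unfolding enriched_iff[OF that(1)] less_cong[OF \<open>k \<in> _\<close> \<open>l \<in> _\<close>] by blast
  qed
  have inv_word: "?w (std \<epsilon> n w) (restrict (w \<circ> inv (std \<epsilon> n w)) {1..n}) = w"
    if "w \<in> {1..n} \<rightarrow>\<^sub>E {lo..<hi}" for w
  proof
    fix k
    show "?w (std \<epsilon> n w) (restrict (w \<circ> inv (std \<epsilon> n w)) {1..n}) k = w k"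
      using that permutes_in_image[OF std_permutes, of \<epsilon> n w k] permutes_inverses[OF std_permutes, of \<epsilon> n w]
      by (auto simp: restrict_def PiE_iff extensional_def)
  qed
  have "(\<Sum>\<pi> | \<pi> permutes {1..n}. card (?E \<pi>) * \<Phi> (ascents n \<pi>)) =
      (\<Sum>\<pi> | \<pi> permutes {1..n}. \<Sum>g\<in>?E \<pi>. \<Phi> (ascents n \<pi>))"
    by simp
  also have "\<dots> = (\<Sum>(\<pi>, g)\<in>Sigma {\<pi>. \<pi> permutes {1..n}} ?E. \<Phi> (ascents n \<pi>))"
    by (subst sum.Sigma) (auto simp: finite_permutations enriched_def finite_chains)
  also have "\<dots> = (\<Sum>w\<in>{1..n} \<rightarrow>\<^sub>E {lo..<hi}. \<Phi> (signed_ascents \<epsilon> n w))"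
  proof (rule sum.reindex_bij_witness[where
        i = "\<lambda>w. (std \<epsilon> n w, restrict (w \<circ> inv (std \<epsilon> n w)) {1..n})" and j = "\<lambda>(\<pi>, g). ?w \<pi> g"],
      goal_cases)
    case (1 p)
    obtain \<pi> g where p: "p = (\<pi>, g)" "\<pi> permutes {1..n}" "g \<in> ?E \<pi>" using 1 by auto
    have "restrict (?w \<pi> g \<circ> inv \<pi>) {1..n} k = g k" for k
      using p(2,3) permutes_in_image[OF permutes_inv[OF p(2)], of k] permutes_inverses[OF p(2)]
      by (auto simp: restrict_def PiE_iff extensional_def enriched_def chains_def)
    then have "restrict (?w \<pi> g \<circ> inv \<pi>) {1..n} = g" by (rule ext)
    then show ?case unfolding p(1) prod.case std[OF p(2,3)] by (rule arg_cong)
  next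
    case (2 p)
    then obtain \<pi> g where p: "p = (\<pi>, g)" "\<pi> permutes {1..n}" "g \<in> ?E \<pi>" by auto
    have "g (\<pi> k) \<in> {lo..<hi}" if "k \<in> {1..n}" for k
    proof -
      have "\<pi> k \<in> {1..n}" using permutes_in_image[OF p(2)] that by blast
      moreover have "g \<in> {1..n} \<rightarrow>\<^sub>E {lo..<hi}" using p(3) by (simp add: enriched_def chains_def)
      ultimately show ?thesis by (rule PiE_mem[rotated])
    qed
    then show ?case by (simp add: p(1))
  next
    case (3 w)
    then show ?case using inv_word by simp
  next
    case (4 w)
    let ?g = "restrict (w \<circ> inv (std \<epsilon> n w)) {1..n}"
    have "?g \<in> {1..n} \<rightarrow>\<^sub>E {lo..<hi}"
      using 4 permutes_in_image[OF permutes_inv[OF std_permutes], of \<epsilon> n w] by auto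
    moreover have "signed_less \<epsilon> (?g \<circ> std \<epsilon> n w) k l"
      if "k \<in> {1..n}" "l \<in> {1..n}" "std \<epsilon> n w k < std \<epsilon> n w l" for k l
      using that std_less_iff[of k n l \<epsilon> w] less_cong[OF that(1,2), of ?g "std \<epsilon> n w"]
      unfolding inv_word[OF 4] by blast
    ultimately have "?g \<in> ?E (std \<epsilon> n w)" unfolding enriched_iff[OF std_permutes] by blast
    then show ?case using std_permutes by blast
  next
    case (5 p)
    obtain \<pi> g where p: "p = (\<pi>, g)" "\<pi> permutes {1..n}" "g \<in> ?E \<pi>" using 5 by auto
    let ?v = "?w \<pi> g"
    \<comment> \<open>An ascent of the standardization at \<open>k\<close> is the signed comparison
      of the neighbouring positions \<open>k\<close> and \<open>Suc k\<close>, so the weight can be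
      computed from the word.\<close>
    have "signed_ascents \<epsilon> n ?v = {k \<in> {1..<n}. signed_less \<epsilon> ?v k (Suc k)}"
      unfolding signed_ascents_def signed_less_def by auto
    also have "\<dots> = ascents n (std \<epsilon> n ?v)"
      unfolding ascents_def by (auto simp: std_less_iff)
    also have "\<dots> = ascents n \<pi>" by (simp only: std[OF p(2,3)])
    finally show ?case by (simp add: p(1))
  qed
  finally show ?thesis .
qed

section \<open>Sorted words of signed pairs\<close>

text \<open>Letters come in pairs \<open>2 * m\<close>, \<open>2 * m + 1\<close>. The even one
  occurs at most once and contributes \<open>1 + fps_X\<close>, the odd one any number of times and
  contributes \<open>1 / (1 - fps_X)\<close>.\<close>

lemma chains_alternating_gf:
  "Abs_fps (\<lambda>n. of_nat (card (chains (\<lambda>_. odd) n 0 (2 * m)))) = ((1 + fps_X) / (1 - fps_X) :: rat fps) ^ m"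
proof (induction m)
  case 0
  show ?case
  proof (rule fps_ext)
    fix n show "fps_nth (Abs_fps (\<lambda>n. of_nat (card (chains (\<lambda>_. odd) n 0 (2 * 0))))) n =
        fps_nth (((1 + fps_X) / (1 - fps_X) :: rat fps) ^ 0) n"
      by (cases n) auto
  qed
next
  case (Suc m)
  define G :: "nat \<Rightarrow> rat fps" where
    "G = (\<lambda>v. Abs_fps (\<lambda>n. of_nat (card (chains (\<lambda>_. odd) n 0 v))))"
  have even: "G (Suc v) = (1 + fps_X) * G v" if "even v" for v
  proof (rule fps_ext)
    fix n show "fps_nth (G (Suc v)) n = fps_nth ((1 + fps_X) * G v) n"
      using that by (cases n) (simp_all add: G_def distrib_right card_chains_Suc)
  qed
  have odd: "G (Suc v) = G v + fps_X * G (Suc v)" if "odd v" for v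
  proof (rule fps_ext)
    fix n show "fps_nth (G (Suc v)) n = fps_nth (G v + fps_X * G (Suc v)) n"
      using that by (cases n) (simp_all add: G_def card_chains_Suc)
  qed
  have "(1 - fps_X) * G (Suc (Suc (2 * m))) = (1 + fps_X) * G (2 * m)"
    using odd[of "Suc (2 * m)"] even[of "2 * m"] by (simp add: algebra_simps)
  then have "inverse (1 - fps_X) * (1 - fps_X) * G (2 * Suc m) = (1 + fps_X) * inverse (1 - fps_X) * G (2 * m)"
    by (simp add: mult_ac)
  then have "G (2 * Suc m) = (1 + fps_X) / (1 - fps_X) * G (2 * m)"
    by (simp add: fps_divide_unit inverse_mult_eq_1)
  then show ?case using Suc by (simp add: G_def)
qed

text \<open>
  The pairs \<open>(f, w)\<close> are numbered row by row, every second row backwards; then exactly the pairs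
  of positive sign, which may be repeated, receive odd numbers.
\<close>

lemma signed_pair_code_step:
  fixes f w f' w' j :: nat
  defines "c \<equiv> \<lambda>f w. f * (2 * j) + (if even f then w - 1 else 2 * j - w)"
  assumes "w \<in> {1..<2 * j + 1}" "w' \<in> {1..<2 * j + 1}"
  shows "(c f w < c f' w' \<or> c f w = c f' w' \<and> odd (c f w)) \<longleftrightarrow>
    (f < f' \<or> f = f' \<and> (even f \<longleftrightarrow> w < w' \<or> w = w' \<and> even w))"
proof -
  have *: "c f w < c f' w'" if "f < f'" "w \<in> {1..<2 * j + 1}" for f w f' w'
  proof -
    have "c f w < Suc f * (2 * j)" using that(2) by (auto simp: c_def)
    also have "\<dots> \<le> f' * (2 * j)" using that(1) by (intro mult_le_mono1) simp
    also have "\<dots> \<le> c f' w'" by (simp add: c_def)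
    finally show ?thesis .
  qed
  consider "f < f'" | "f' < f" | "f = f'" by linarith
  then show ?thesis
  proof cases
    case 1 then show ?thesis using *[OF 1 assms(2)] by simp
  next
    case 2 then show ?thesis using *[OF 2 assms(3), of w] by simp
  next
    case 3
    \<comment> \<open>Reversing a row keeps the parity of \<open>w\<close>, shifting it by one flips
      it; hence the odd codes are the pairs whose two entries have equal signs.\<close>
    have "2 * j - w < 2 * j - w' \<longleftrightarrow> w' < w" "2 * j - w = 2 * j - w' \<longleftrightarrow> w = w'"
      "w - 1 < w' - 1 \<longleftrightarrow> w < w'" "w - 1 = w' - 1 \<longleftrightarrow> w = w'"
      "odd (2 * j - w) \<longleftrightarrow> odd w" "odd (w - 1) \<longleftrightarrow> even w"
      using assms(2,3) by auto
    then show ?thesis using 3 unfolding c_def by (cases "even f") auto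
  qed
qed

text \<open>Two words of length \<open>n\<close> form one word of pairs, and numbering the pairs
  merges the two chain conditions into a single one.\<close>

lemma card_signed_pairs:
  assumes "n \<ge> 1"
  shows "(\<Sum>w\<in>{1..n} \<rightarrow>\<^sub>E {1..<2 * j + 1}. card (enriched even (signed_ascents even n w) n 0 (2 * i + 1))) =
    card (chains (\<lambda>_. odd) n 0 (2 * (2 * i * j + j)))"
\<comment> \<open>The decoding divides by \<open>2 * j\<close>, so the empty alphabet is treated
  apart.\<close>
proof (cases "j = 0")
  case True
  have "{1..n} \<rightarrow>\<^sub>E {1..<1::nat} = {}" using assms by (auto simp: PiE_eq_empty_iff)
  then show ?thesis using assms True by simp
next
  case False
  define c where "c = (\<lambda>f w. f * (2 * j) + (if even f then w - 1 else 2 * j - w))"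
  define d where "d = (\<lambda>a. if even (a div (2 * j)) then a mod (2 * j) + 1 else 2 * j - a mod (2 * j))"
  have M: "2 * (2 * i * j + j) = (2 * i + 1) * (2 * j)" by (simp add: algebra_simps)
  have digit: "(if even f then w - 1 else 2 * j - w) < 2 * j" if "w \<in> {1..<2 * j + 1}" for f w :: nat
    using that False by auto
  have c_div: "c f w div (2 * j) = f" if "w \<in> {1..<2 * j + 1}" for f w
    using digit[OF that, of f] by (simp add: c_def del: if_split)
  have c_mod: "c f w mod (2 * j) = (if even f then w - 1 else 2 * j - w)" if "w \<in> {1..<2 * j + 1}" for f w
    using digit[OF that, of f] by (simp add: c_def del: if_split)
  have d_c: "d (c f w) = w" if "w \<in> {1..<2 * j + 1}" for f w
    unfolding d_def c_div[OF that] c_mod[OF that] using that by auto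
  have d_mem: "d a \<in> {1..<2 * j + 1}" for a
    using False by (auto simp: d_def Suc_le_eq)
  have c_d: "c (a div (2 * j)) (d a) = a" for a
  proof -
    have "(if even (a div (2 * j)) then d a - 1 else 2 * j - d a) = a mod (2 * j)"
      using False by (simp add: d_def less_imp_le)
    then show ?thesis unfolding c_def by (simp only: div_mult_mod_eq)
  qed
  have c_less: "c f w < (2 * i + 1) * (2 * j) \<longleftrightarrow> f < 2 * i + 1" if "w \<in> {1..<2 * j + 1}" for f w
    using c_div[OF that, of f] False by (metis div_less_iff_less_mult mult_pos_pos neq0_conv zero_less_numeral)
  have step: "(c f w < c f' w' \<or> c f w = c f' w' \<and> odd (c f w)) \<longleftrightarrow>
    (f < f' \<or> f = f' \<and> (even f \<longleftrightarrow> w < w' \<or> w = w' \<and> even w))"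
    if "w \<in> {1..<2 * j + 1}" "w' \<in> {1..<2 * j + 1}" for f w f' w'
    using signed_pair_code_step[OF that, of f f'] unfolding c_def .
  let ?W = "{1..n} \<rightarrow>\<^sub>E {1..<2 * j + 1}"
  let ?F = "\<lambda>w. enriched even (signed_ascents even n w) n 0 (2 * i + 1)"
  \<comment> \<open>Restricting the codes to \<open>{1..n}\<close> forgets the values of
    \<open>f\<close> elsewhere, which is why \<open>extensional\<close> appears as a separate
    condition.\<close>
  have F_iff: "f \<in> ?F w \<longleftrightarrow> f \<in> extensional {1..n} \<and>
      restrict (\<lambda>k. c (f k) (w k)) {1..n} \<in> chains (\<lambda>_. odd) n 0 (2 * (2 * i * j + j))"
    (is "_ \<longleftrightarrow> _ \<and> ?h \<in> _") if w: "w \<in> ?W" for f w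
  proof -
    have wk: "w k \<in> {1..<2 * j + 1}" if "k \<in> {1..n}" for k using w that by blast
    have "?h k < ?h (Suc k) \<or> ?h k = ?h (Suc k) \<and> odd (?h k) \<longleftrightarrow>
        f k < f (Suc k) \<or> f k = f (Suc k) \<and> (even (f k) \<longleftrightarrow> k \<in> signed_ascents even n w)"
      if k: "k \<in> {1..<n}" for k
    proof -
      have mem: "k \<in> {1..n}" "Suc k \<in> {1..n}" using k by auto
      then have "?h k = c (f k) (w k)" "?h (Suc k) = c (f (Suc k)) (w (Suc k))" by auto
      moreover have "k \<in> signed_ascents even n w \<longleftrightarrow> w k < w (Suc k) \<or> w k = w (Suc k) \<and> even (w k)"
        using k by (simp add: signed_ascents_def)
      ultimately show ?thesis using step[OF mem[THEN wk], of "f k" "f (Suc k)"] by simp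
    qed
    moreover have "f \<in> {1..n} \<rightarrow>\<^sub>E {0..<2 * i + 1} \<longleftrightarrow> f \<in> extensional {1..n} \<and>
        ?h \<in> {1..n} \<rightarrow>\<^sub>E {0..<2 * (2 * i * j + j)}"
      unfolding M using wk c_less by (simp add: PiE_iff) blast
    ultimately show ?thesis unfolding enriched_def chains_def by blast
  qed
  have "(\<Sum>w\<in>?W. card (?F w)) = card (Sigma ?W ?F)"
    by (rule card_SigmaI[symmetric]) (auto simp: enriched_def finite_chains finite_PiE)
  also have "\<dots> = card (chains (\<lambda>_. odd) n 0 (2 * (2 * i * j + j)))"
  proof (rule bij_betw_same_card, rule bij_betw_byWitness[where
        f = "\<lambda>(w, f). restrict (\<lambda>k. c (f k) (w k)) {1..n}" and
        f' = "\<lambda>h. (restrict (d \<circ> h) {1..n}, restrict (\<lambda>k. h k div (2 * j)) {1..n})"], goal_cases)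
    case 1
    show ?case
    proof (intro ballI)
      fix p assume "p \<in> Sigma ?W ?F"
      then obtain w f where p: "p = (w, f)" "w \<in> ?W" "f \<in> ?F w" by blast
      have wk: "w k \<in> {1..<2 * j + 1}" if "k \<in> {1..n}" for k using p(2) that by blast
      let ?h = "restrict (\<lambda>k. c (f k) (w k)) {1..n}"
      have "restrict (d \<circ> ?h) {1..n} = restrict w {1..n}"
        by (rule restrict_ext) (use d_c wk in auto)
      moreover have "restrict (\<lambda>k. ?h k div (2 * j)) {1..n} = restrict f {1..n}"
        by (rule restrict_ext) (use c_div wk in auto)
      moreover have "restrict w {1..n} = w" "restrict f {1..n} = f"
        using p(2,3) F_iff[OF p(2)] by (auto simp: PiE_iff intro: extensional_restrict)
      ultimately show "(\<lambda>h. (restrict (d \<circ> h) {1..n}, restrict (\<lambda>k. h k div (2 * j)) {1..n}))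
          ((\<lambda>(w, f). restrict (\<lambda>k. c (f k) (w k)) {1..n}) p) = p"
        by (simp only: p(1) prod.case)
    qed
  next
    case 2
    have "restrict (\<lambda>k. c (restrict (\<lambda>k. h k div (2 * j)) {1..n} k) (restrict (d \<circ> h) {1..n} k)) {1..n} = h"
      if "h \<in> chains (\<lambda>_. odd) n 0 (2 * (2 * i * j + j))" for h
    proof -
      have "restrict (\<lambda>k. c (restrict (\<lambda>k. h k div (2 * j)) {1..n} k) (restrict (d \<circ> h) {1..n} k)) {1..n}
          = restrict h {1..n}"
        by (rule restrict_ext) (simp add: c_d)
      also have "\<dots> = h" using that by (auto simp: chains_def PiE_iff intro: extensional_restrict)
      finally show ?thesis .
    qed
    then show ?case by simp
  next
    case 3
    then show ?case using F_iff by fast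
  next
    case 4
    have "restrict (\<lambda>k. h k div (2 * j)) {1..n} \<in> ?F (restrict (d \<circ> h) {1..n})"
      if h: "h \<in> chains (\<lambda>_. odd) n 0 (2 * (2 * i * j + j))" for h
    proof -
      have W: "restrict (d \<circ> h) {1..n} \<in> ?W" using d_mem by auto
      have "restrict (\<lambda>k. c (restrict (\<lambda>k. h k div (2 * j)) {1..n} k) (restrict (d \<circ> h) {1..n} k)) {1..n}
          = restrict h {1..n}"
        by (rule restrict_ext) (simp add: c_d)
      also have "\<dots> = h" using h by (auto simp: chains_def PiE_iff intro: extensional_restrict)
      finally show ?thesis unfolding F_iff[OF W] using h by simp
    qed
    then show ?case using d_mem by auto
  qed
  finally show ?thesis .
qed

text \<open>Standardization, with the left enriched count as weight, replaces permutations by words;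
  the ascents of \<pi> become the signed ascents of the word.\<close>

lemma sum_enriched_pairs:
  assumes "n \<ge> 1"
  shows "(\<Sum>\<pi> | \<pi> permutes {1..n}. of_nat (card (enriched even (ascents n \<pi>) n 0 (2 * i + 1)) *
      card (enriched even (ascents n (inv \<pi>)) n 1 (2 * j + 1)))) =
    fps_nth (((1 + fps_X) / (1 - fps_X) :: rat fps) ^ (2 * i * j + j)) n"
proof -
  have "(\<Sum>\<pi> | \<pi> permutes {1..n}. card (enriched even (ascents n (inv \<pi>)) n 1 (2 * j + 1)) *
      card (enriched even (ascents n \<pi>) n 0 (2 * i + 1))) =
    card (chains (\<lambda>_. odd) n 0 (2 * (2 * i * j + j)))"
    unfolding standardization[where \<Phi> = "\<lambda>S. card (enriched even S n 0 (2 * i + 1))"]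
    by (rule card_signed_pairs[OF assms])
  then have "(\<Sum>\<pi> | \<pi> permutes {1..n}. card (enriched even (ascents n \<pi>) n 0 (2 * i + 1)) *
      card (enriched even (ascents n (inv \<pi>)) n 1 (2 * j + 1))) =
    card (chains (\<lambda>_. odd) n 0 (2 * (2 * i * j + j)))"
    by (simp add: mult.commute)
  then show ?thesis
    unfolding chains_alternating_gf[symmetric] fps_nth_Abs_fps of_nat_sum[symmetric] by (rule arg_cong)
qed

section \<open>Generating functions by peaks\<close>

lemma card_enriched_Suc:
  assumes "n \<ge> 1" "lo \<le> 1"
  shows "card (enriched \<epsilon> S (Suc n) lo (Suc v)) = card (enriched \<epsilon> S (Suc n) lo v) +
    card (enriched \<epsilon> S n lo (if \<epsilon> v \<longleftrightarrow> n \<in> S then Suc v else v))"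
proof (cases "lo \<le> v")
  case True
  then show ?thesis unfolding enriched_def by (rule card_chains_Suc)
next
  case False
  \<comment> \<open>Here \<open>lo = 1\<close> and \<open>v = 0\<close>, so all three letter ranges
    are empty.\<close>
  have "chains R m lo u = {}" if "u \<le> lo" "m \<ge> 1" for R m u
    using that by (auto simp: chains_def PiE_eq_empty_iff)
  then show ?thesis using False assms by (simp add: enriched_def)
qed

lemma card_enriched_1: "card (enriched \<epsilon> S 1 lo hi) = hi - lo"
proof -
  have "enriched \<epsilon> S 1 lo hi = {1} \<rightarrow>\<^sub>E {lo..<hi}" by (auto simp: enriched_def chains_def)
  then show ?thesis by (simp add: card_PiE)
qed

lemma card_enriched_0:
  assumes "n \<ge> 1"
  shows "card (enriched \<epsilon> S n lo 0) = 0"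
proof -
  have "{1..n} \<rightarrow>\<^sub>E {lo..<0} = {}" using assms by (intro PiE_empty_range[of 1]) auto
  then show ?thesis unfolding enriched_def chains_def by simp
qed

lemma geometric_1_minus_X: "(1 - fps_X) * Abs_fps (\<lambda>_. 1) = (1 :: 'a::comm_ring_1 fps)"
proof (rule fps_ext)
  fix n show "fps_nth ((1 - fps_X) * Abs_fps (\<lambda>_. 1)) n = fps_nth (1 :: 'a fps) n"
    by (cases n) (simp_all add: left_diff_distrib)
qed

lemma arithmetic_1_minus_X:
  "(1 - fps_X)\<^sup>2 * Abs_fps (\<lambda>i. of_nat (a * i + b)) = fps_const (of_nat b) + fps_const (of_nat a - of_nat b) * (fps_X :: 'a::comm_ring_1 fps)"
proof -
  have 1: "(1 - fps_X) * Abs_fps (\<lambda>i. of_nat (a * i + b)) =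
    fps_const (of_nat a) * Abs_fps (\<lambda>_. 1) + (fps_const (of_nat b - of_nat a) :: 'a fps)"
  proof (rule fps_ext)
    fix n show "fps_nth ((1 - fps_X) * Abs_fps (\<lambda>i. of_nat (a * i + b))) n =
      fps_nth (fps_const (of_nat a) * Abs_fps (\<lambda>_. 1) + (fps_const (of_nat b - of_nat a) :: 'a fps)) n"
      by (cases n) (simp_all add: left_diff_distrib algebra_simps)
  qed
  have "(1 - fps_X)\<^sup>2 * Abs_fps (\<lambda>i. of_nat (a * i + b)) =
    fps_const (of_nat a) * ((1 - fps_X) * Abs_fps (\<lambda>_. 1)) +
    (1 - fps_X) * (fps_const (of_nat b - of_nat a) :: 'a fps)"
    unfolding power2_eq_square mult.assoc 1 by (simp add: algebra_simps)
  also have "\<dots> = fps_const (of_nat b) + fps_const (of_nat a - of_nat b) * fps_X"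
    unfolding geometric_1_minus_X
    by (simp add: algebra_simps flip: fps_const_sub)
  finally show ?thesis .
qed

text \<open>
  For \<open>lo = 0\<close> the word is treated as if preceded by an ascent, so that a descent at \<open>1\<close> creates a
  left peak; for \<open>lo = 1\<close> as if preceded by a descent.
\<close>

definition after_ascent :: "nat \<Rightarrow> nat set \<Rightarrow> nat \<Rightarrow> bool" where
  "after_ascent lo S i \<longleftrightarrow> (if i = 1 then lo = 0 else i - 1 \<in> S)"

definition n_peaks :: "nat \<Rightarrow> nat set \<Rightarrow> nat \<Rightarrow> nat" where
  "n_peaks lo S n = card {i \<in> {1..<n}. i \<notin> S \<and> after_ascent lo S i}"

lemma n_peaks_Suc:
  "n \<ge> 1 \<Longrightarrow> n_peaks lo S (Suc n) = n_peaks lo S n + (if n \<notin> S \<and> after_ascent lo S n then 1 else 0)"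
proof -
  assume "n \<ge> 1"
  then have "{i \<in> {1..<Suc n}. i \<notin> S \<and> after_ascent lo S i} =
    {i \<in> {1..<n}. i \<notin> S \<and> after_ascent lo S i} \<union> (if n \<notin> S \<and> after_ascent lo S n then {n} else {})"
    by (auto simp: less_Suc_eq)
  then show ?thesis unfolding n_peaks_def by (auto simp: card_insert_if)
qed

text \<open>The odd upper bounds are those of the two alphabets in question; the even ones arise
  because letters are added one at a time. The coefficient ring is left general: it is the rationals
  for \<open>s\<close> and a power series ring for \<open>t\<close>.\<close>

context
  fixes S :: "nat set" and lo :: nat and A B :: "nat \<Rightarrow> 'a::idom fps"
  assumes lo: "lo \<le> 1"
  defines "A \<equiv> \<lambda>n. Abs_fps (\<lambda>i. of_nat (card (enriched even S n lo (2 * i + 1))))"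
    and "B \<equiv> \<lambda>n. Abs_fps (\<lambda>i. of_nat (card (enriched even S n lo (2 * i))))"
begin

lemma odd_bound_gf_Suc:
  assumes "n \<ge> 1"
  shows "A (Suc n) = B (Suc n) + (if n \<in> S then A n else B n)"
  by (rule fps_ext) (use card_enriched_Suc[OF assms lo, of even S] in \<open>simp add: A_def B_def\<close>)

text \<open>The letter added is the negative \<open>2 * k + 1\<close>, repeatable only where there
  is no ascent. Lowering the bound to \<open>2 * k + 1\<close> lowers the index from
  \<open>k + 1\<close> to \<open>k\<close>, whence the factors \<open>fps_X\<close>.\<close>

lemma even_bound_gf_Suc:
  assumes "n \<ge> 1"
  shows "B (Suc n) = fps_X * A (Suc n) + (if n \<in> S then fps_X * A n else B n)"
proof (rule fps_ext)
  fix i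
  show "fps_nth (B (Suc n)) i = fps_nth (fps_X * A (Suc n) + (if n \<in> S then fps_X * A n else B n)) i"
  proof (cases i)
    case 0
    then show ?thesis using assms by (simp add: A_def B_def card_enriched_0)
  next
    case (Suc k)
    then show ?thesis
      using card_enriched_Suc[OF assms lo, of even S "Suc (2 * k)"] by (simp add: A_def B_def)
  qed
qed

lemma odd_bound_gf_1: "(1 - fps_X)\<^sup>2 * A 1 = (if lo = 0 then 1 + fps_X else 2 * fps_X)"
proof (cases "lo = 0")
  case True
  then have "A 1 = Abs_fps (\<lambda>i. of_nat (2 * i + 1))"
    unfolding A_def card_enriched_1 by simp
  then show ?thesis using True arithmetic_1_minus_X[of 2 1, where ?'a = 'a] by simp
next
  case False
  then have "lo = 1" using lo by simp
  then have "A 1 = Abs_fps (\<lambda>i. of_nat (2 * i + 0))"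
    unfolding A_def card_enriched_1 by simp
  then show ?thesis
    using \<open>lo = 1\<close> arithmetic_1_minus_X[of 2 0, where ?'a = 'a] by (simp add: numeral_fps_const)
qed

text \<open>The initial ratio of \<open>B\<close> to \<open>A\<close> is the one found after an
  ascent if \<open>lo = 0\<close> and after a descent if \<open>lo = 1\<close>; this justifies the
  fictitious preceding step.\<close>

lemma even_bound_gf_1: "if lo = 0 then (1 + fps_X) * B 1 = 2 * fps_X * A 1 else 2 * B 1 = (1 + fps_X) * A 1"
proof (cases "lo = 0")
  case True
  then have "B 1 = Abs_fps (\<lambda>i. of_nat (2 * i + 0))"
    unfolding B_def card_enriched_1 by simp
  then have "(1 - fps_X)\<^sup>2 * B 1 = 2 * fps_X"
    using arithmetic_1_minus_X[of 2 0, where ?'a = 'a] by (simp add: numeral_fps_const)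
  then have "(1 - fps_X)\<^sup>2 * ((1 + fps_X) * B 1) = (1 - fps_X)\<^sup>2 * (2 * fps_X * A 1)"
    using odd_bound_gf_1 True by (simp add: mult.left_commute)
  moreover have "(1 - fps_X)\<^sup>2 \<noteq> (0 :: 'a fps)" by (auto simp: fps_eq_iff intro!: exI[of _ 0])
  ultimately have "(1 + fps_X) * B 1 = 2 * fps_X * A 1" by simp
  then show ?thesis using True by simp
next
  case False
  then have "lo = 1" using lo by simp
  \<comment> \<open>At \<open>i = 0\<close> the natural subtraction yields 0 instead of -1; the
    summand 1 on the right makes up for it.\<close>
  have "B 1 + Abs_fps (\<lambda>_. 1) = Abs_fps (\<lambda>i. of_nat (2 * i)) + 1"
  proof (rule fps_ext)
    fix i show "fps_nth (B 1 + Abs_fps (\<lambda>_. 1)) i = fps_nth (Abs_fps (\<lambda>i. of_nat (2 * i)) + 1) i"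
      unfolding B_def card_enriched_1 \<open>lo = 1\<close> by (cases i) simp_all
  qed
  then have B: "B 1 = Abs_fps (\<lambda>i. of_nat (2 * i + 0)) + 1 - Abs_fps (\<lambda>_. 1)" by (simp add: algebra_simps)
  have "(1 - fps_X)\<^sup>2 * B 1 = 2 * fps_X + (1 - fps_X)\<^sup>2 - (1 - fps_X)"
    unfolding B ring_distribs arithmetic_1_minus_X unfolding power2_eq_square mult.assoc geometric_1_minus_X
    by (simp add: numeral_fps_const)
  also have "\<dots> = fps_X * (1 + fps_X)" by (simp add: power2_eq_square algebra_simps)
  finally have "(1 - fps_X)\<^sup>2 * (2 * B 1) = (1 - fps_X)\<^sup>2 * ((1 + fps_X) * A 1)"
    using odd_bound_gf_1 \<open>lo = 1\<close> by (simp add: mult.left_commute)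
  moreover have "(1 - fps_X)\<^sup>2 \<noteq> (0 :: 'a fps)" by (auto simp: fps_eq_iff intro!: exI[of _ 0])
  ultimately have "2 * B 1 = (1 + fps_X) * A 1" by simp
  then show ?thesis using False by simp
qed

text \<open>
  The second component records the ratio of \<open>B\<close> to \<open>A\<close>, which only depends on whether the last step
  was an ascent; only the transition from an ascent to a descent costs a factor
  \<open>4X / (1 + X)\<^sup>2\<close>.
\<close>

lemma enriched_gf_invariant:
  assumes "n \<ge> 1"
  shows "A n * (1 - fps_X) ^ (n + 1) * (1 + fps_X) ^ (2 * n_peaks lo S n) =
      (if lo = 0 then 1 + fps_X else 2 * fps_X) * (1 + fps_X) ^ (n - 1) * (4 * fps_X) ^ n_peaks lo S n \<and>
    (if after_ascent lo S n then (1 + fps_X) * B n = 2 * fps_X * A n else 2 * B n = (1 + fps_X) * A n)"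
  using assms
proof (induction n rule: dec_induct)
  case base
  then show ?case using odd_bound_gf_1 even_bound_gf_1 by (simp add: n_peaks_def after_ascent_def power2_eq_square mult_ac)
next
  case (step n)
  define p u :: "'a fps" where "p = 1 + fps_X" and "u = 1 - fps_X"
  define r where "r = n_peaks lo S n"
  define K :: "'a fps" where "K = (if lo = 0 then 1 + fps_X else 2 * fps_X)"
  have IH: "A n * u ^ (n + 1) * p ^ (2 * r) = K * p ^ (n - 1) * (4 * fps_X) ^ r"
    and IH': "if after_ascent lo S n then p * B n = 2 * fps_X * A n else 2 * B n = p * A n"
    using step.IH by (fold p_def u_def r_def K_def) blast+
  have pn: "p ^ n = p * p ^ (n - 1)" using step.hyps by (cases n) auto
  note AS = odd_bound_gf_Suc[OF step.hyps(1)] and BS = even_bound_gf_Suc[OF step.hyps(1)]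
  have next_state: "after_ascent lo S (Suc n) \<longleftrightarrow> n \<in> S" using step.hyps by (simp add: after_ascent_def)
  \<comment> \<open>Eliminating the old series from the two recurrences gives the new ratio,
    whatever the previous step was.\<close>
  have second: "if n \<in> S then p * B (Suc n) = 2 * fps_X * A (Suc n) else 2 * B (Suc n) = p * A (Suc n)"
  proof (cases "n \<in> S")
    case True
    have "A (Suc n) = B (Suc n) + A n" "B (Suc n) = fps_X * A (Suc n) + fps_X * A n"
      using AS BS True by simp_all
    then have "p * B (Suc n) = 2 * fps_X * A (Suc n)" unfolding p_def by algebra
    then show ?thesis using True by simp
  next
    case False
    have "A (Suc n) = B (Suc n) + B n" "B (Suc n) = fps_X * A (Suc n) + B n"
      using AS BS False by simp_all
    then have "2 * B (Suc n) = p * A (Suc n)" unfolding p_def by algebra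
    then show ?thesis using False by simp
  qed
  have first: "A (Suc n) * u ^ (n + 2) * p ^ (2 * n_peaks lo S (Suc n)) =
    K * p ^ n * (4 * fps_X) ^ n_peaks lo S (Suc n)"
  proof (cases "n \<notin> S \<and> after_ascent lo S n")
    case True
    \<comment> \<open>At a peak the recurrences give \<open>u * A (Suc n) = 2 * B n\<close>, and the
      ratio after an ascent turns this into
      \<open>u * p * A (Suc n) = 4 * fps_X * A n\<close>.\<close>
    have "A (Suc n) = B (Suc n) + B n" "B (Suc n) = fps_X * A (Suc n) + B n"
      using AS BS True by simp_all
    moreover have "p * B n = 2 * fps_X * A n" using IH' True by simp
    ultimately have *: "u * p * A (Suc n) = 4 * fps_X * A n" unfolding u_def by algebra
    have "A (Suc n) * u ^ (n + 2) * p ^ (2 * Suc r) =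
        (u * p * A (Suc n)) * p * u ^ (n + 1) * p ^ (2 * r)" by (simp add: mult_ac)
    also have "\<dots> = 4 * fps_X * p * (A n * u ^ (n + 1) * p ^ (2 * r))"
      unfolding * by (simp only: mult_ac)
    also have "\<dots> = K * p ^ n * (4 * fps_X) ^ Suc r"
      unfolding IH pn by (simp add: mult_ac)
    also have "Suc r = n_peaks lo S (Suc n)" using True n_peaks_Suc[OF step.hyps(1), of lo S] by (simp add: r_def)
    finally show ?thesis .
  next
    case False
    \<comment> \<open>Without a peak the step multiplies by \<open>p / u\<close>: at an ascent by
      the recurrences alone, at a descent after a descent by the recorded ratio.\<close>
    have "u * A (Suc n) = p * A n"
    proof (cases "n \<in> S")
      case True
      have "A (Suc n) = B (Suc n) + A n" "B (Suc n) = fps_X * A (Suc n) + fps_X * A n"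
        using AS BS True by simp_all
      then show ?thesis unfolding p_def u_def by algebra
    next
      case notin: False
      have "A (Suc n) = B (Suc n) + B n" "B (Suc n) = fps_X * A (Suc n) + B n"
        using AS BS notin by simp_all
      moreover have "2 * B n = p * A n" using IH' False notin by simp
      ultimately show ?thesis unfolding u_def by algebra
    qed
    then have "A (Suc n) * u ^ (n + 2) * p ^ (2 * r) = p * (A n * u ^ (n + 1) * p ^ (2 * r))"
      by (simp add: mult_ac)
    also have "\<dots> = K * p ^ n * (4 * fps_X) ^ r" unfolding IH pn by (simp add: mult_ac)
    also have "r = n_peaks lo S (Suc n)" using False n_peaks_Suc[OF step.hyps(1), of lo S] by (auto simp: r_def)
    finally show ?thesis .
  qed
  show ?case
    using first second unfolding next_state p_def u_def K_def by (auto simp del: power_Suc)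
qed

end

section \<open>Peaks and left peaks of permutations as descents after ascents\<close>

lemma n_peaks_lpk:
  assumes "\<pi> permutes {1..n}" "n \<ge> 1"
  shows "n_peaks 0 (ascents n \<pi>) n = lpk n \<pi>"
proof -
  have neq: "\<pi> i \<noteq> \<pi> (Suc i)" for i using permutes_inj[OF assms(1)] by (metis injD n_not_Suc_n)
  have "(i \<notin> ascents n \<pi> \<and> after_ascent 0 (ascents n \<pi>) i) \<longleftrightarrow>
      is_peak n \<pi> i \<or> i = 1 \<and> \<pi> 1 > \<pi> 2" if i: "i \<in> {1..<n}" for i
  proof (cases "i = 1")
    case True
    then show ?thesis using that neq[of 1]
      by (auto simp: ascents_def after_ascent_def is_peak_def numeral_2_eq_2 not_less_iff_gr_or_eq)
  next
    case False
    then obtain m where "i = Suc m" "m \<ge> 1" using i by (cases i) auto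
    then show ?thesis using that neq[of i]
      by (auto simp: ascents_def after_ascent_def is_peak_def not_less_iff_gr_or_eq)
  qed
  moreover have "{1..<n} = {1..n - 1}" using assms(2) by auto
  ultimately show ?thesis unfolding n_peaks_def lpk_def by (metis (mono_tags, lifting) Collect_cong)
qed

lemma n_peaks_pk:
  assumes "\<pi> permutes {1..n}" "n \<ge> 1"
  shows "n_peaks 1 (ascents n \<pi>) n = pk n \<pi>"
proof -
  have neq: "\<pi> i \<noteq> \<pi> (Suc i)" for i using permutes_inj[OF assms(1)] by (metis injD n_not_Suc_n)
  have "(i \<in> {1..<n} \<and> i \<notin> ascents n \<pi> \<and> after_ascent 1 (ascents n \<pi>) i) \<longleftrightarrow> is_peak n \<pi> i" for i
  proof (cases "i \<in> {2..<n}")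
    case True
    then obtain m where "i = Suc m" "m \<ge> 1" by (cases i) auto
    then show ?thesis using True neq[of i]
      by (auto simp: ascents_def after_ascent_def is_peak_def not_less_iff_gr_or_eq)
  next
    case False
    then show ?thesis using assms(2) by (auto simp: is_peak_def after_ascent_def)
  qed
  then show ?thesis unfolding n_peaks_def pk_def by presburger
qed

text \<open>The part of a summand that involves \<open>s\<close>, namely
  \<open>(1 + s)^n / (1 - s)^(n + 1)\<close> times \<open>(4 s / (1 + s)^2)^lpk\<close>, with
  denominators cleared.\<close>

lemma left_enriched_gf:
  assumes "\<pi> permutes {1..n}" "n \<ge> 1"
  shows "Abs_fps (\<lambda>i. of_nat (card (enriched even (ascents n \<pi>) n 0 (2 * i + 1)))) *
      (1 - fps_X) ^ (n + 1) * (1 + fps_X) ^ (2 * lpk n \<pi>) =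
    (1 + fps_X) ^ n * (4 * fps_X :: 'a::idom fps) ^ lpk n \<pi>"
proof -
  have "(1 + fps_X) * (1 + fps_X) ^ (n - 1) = (1 + fps_X :: 'a fps) ^ n"
    using assms(2) by (cases n) auto
  then show ?thesis
    using enriched_gf_invariant[of 0 n "ascents n \<pi>", where ?'a = 'a] assms by (simp add: n_peaks_lpk)
qed

text \<open>The initial factor \<open>2 * fps_X\<close> of the invariant, once doubled, supplies one
  more \<open>4 * fps_X\<close>. This is the origin of the exponent \<open>pk n \<pi> + 1\<close>
  and of the factor 1/2 in (a).\<close>

lemma enriched_gf:
  assumes "\<pi> permutes {1..n}" "n \<ge> 1"
  shows "2 * Abs_fps (\<lambda>i. of_nat (card (enriched even (ascents n \<pi>) n 1 (2 * i + 1)))) *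
      (1 - fps_X) ^ (n + 1) * (1 + fps_X) ^ (2 * (pk n \<pi> + 1)) =
    (1 + fps_X) ^ (n + 1) * (4 * fps_X :: 'a::idom fps) ^ (pk n \<pi> + 1)"
proof -
  define F U :: "'a fps"
    where "F = Abs_fps (\<lambda>i. of_nat (card (enriched even (ascents n \<pi>) n 1 (2 * i + 1))))"
      and "U = (1 - fps_X) ^ (n + 1)"
  have pn: "(1 + fps_X) ^ (n + 1) = (1 + fps_X)\<^sup>2 * (1 + fps_X :: 'a fps) ^ (n - 1)"
    using assms(2) by (cases n) (auto simp: power2_eq_square)
  have "Abs_fps (\<lambda>i. of_nat (card (enriched even (ascents n \<pi>) n 1 (2 * i + 1)))) *
      (1 - fps_X) ^ (n + 1) * (1 + fps_X) ^ (2 * pk n \<pi>) =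
      2 * fps_X * (1 + fps_X) ^ (n - 1) * (4 * fps_X :: 'a fps) ^ pk n \<pi>"
    using enriched_gf_invariant[of 1 n "ascents n \<pi>", where ?'a = 'a] n_peaks_pk[OF assms] assms by simp
  then have "2 * (1 + fps_X)\<^sup>2 * (F * U * (1 + fps_X) ^ (2 * pk n \<pi>)) =
      2 * (1 + fps_X)\<^sup>2 * (2 * fps_X * (1 + fps_X) ^ (n - 1) * (4 * fps_X) ^ pk n \<pi>)"
    unfolding F_def U_def by (simp only:)
  also have "\<dots> = (1 + fps_X) ^ (n + 1) * (4 * fps_X) ^ (pk n \<pi> + 1)"
    unfolding pn by (simp add: mult_ac)
  also have "2 * (1 + fps_X)\<^sup>2 * (F * U * (1 + fps_X) ^ (2 * pk n \<pi>)) =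
      2 * F * U * (1 + fps_X) ^ (2 * (pk n \<pi> + 1))"
    by (simp add: power2_eq_square mult_ac)
  finally show ?thesis unfolding F_def U_def .
qed

section \<open>Permutations with odd cycles\<close>

definition cycles :: "'a set \<Rightarrow> ('a \<Rightarrow> 'a) \<Rightarrow> 'a set set" where
  "cycles S \<pi> = orbit \<pi> ` S"

lemma finite_cycles: "finite S \<Longrightarrow> finite (cycles S \<pi>)"
  by (simp add: cycles_def)

lemma cycles_subset: "\<pi> permutes S \<Longrightarrow> C \<in> cycles S \<pi> \<Longrightarrow> C \<subseteq> S"
  by (auto simp: cycles_def dest: permutes_orbit_subset)

lemma self_in_orbit: "\<pi> permutes S \<Longrightarrow> finite S \<Longrightarrow> u \<in> orbit \<pi> u"
  by (rule permutation_self_in_orbit) (auto simp: permutation_permutes)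

lemma orbit_eq_iff:
  assumes "\<pi> permutes S" "finite S"
  shows "orbit \<pi> u = orbit \<pi> v \<longleftrightarrow> u \<in> orbit \<pi> v"
proof
  assume "u \<in> orbit \<pi> v"
  then show "orbit \<pi> u = orbit \<pi> v"
    using orbit_cyclic_eq3[OF cyclic_on_orbit[OF assms]] by blast
qed (use self_in_orbit[OF assms] in blast)

section \<open>Inserting a point into a cycle\<close>

lemma transpose_comp_permutes:
  assumes "\<tau> permutes S" "y \<in> insert x S"
  shows "transpose x y \<circ> \<tau> permutes insert x S"
  using permutes_compose[OF permutes_imp_permutes_insert[OF assms(1)] permutes_swap_id[of x "insert x S" y]] assms(2)
  by auto

text \<open>As \<tau> fixes \<open>x\<close>, the composition inserts \<open>x\<close> into the
  cycle of \<open>y\<close>, directly before \<open>y\<close>: the preimage of \<open>y\<close> now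
  goes to \<open>x\<close>, and \<open>x\<close> goes to \<open>y\<close>.\<close>

lemma orbit_transpose_comp:
  assumes "\<tau> permutes S" "finite S" "x \<notin> S" "y \<in> S" "u \<in> S"
  shows "orbit (transpose x y \<circ> \<tau>) u = (if y \<in> orbit \<tau> u then insert x (orbit \<tau> u) else orbit \<tau> u)"
proof -
  let ?\<pi> = "transpose x y \<circ> \<tau>"
  have \<pi>: "?\<pi> permutes insert x S"
    using assms(1,4) by (intro transpose_comp_permutes) auto
  have xy: "?\<pi> x = y" using permutes_not_in[OF assms(1,3)] by simp
  have app: "?\<pi> v = (if \<tau> v = y then x else \<tau> v)" if "v \<in> S" for v
    using permutes_in_image[OF assms(1), of v] that assms(3) by (auto simp: transpose_def)
  have sub: "orbit \<tau> u \<subseteq> S" by (rule permutes_orbit_subset[OF assms(1,5)])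
  \<comment> \<open>A step of \<tau> into \<open>y\<close> becomes two steps, by way of
    \<open>x\<close>.\<close>
  have 1: "v \<in> orbit ?\<pi> u" if "v \<in> orbit \<tau> u" for v
    using that
  proof induction
    case base
    show ?case
    proof (cases "\<tau> u = y")
      case True
      then have "?\<pi> (?\<pi> u) = y" using app[OF assms(5)] xy by simp
      then show ?thesis using True by (metis orbit.base orbit.step)
    next
      case False
      then show ?thesis using app[OF assms(5)] by (metis orbit.base)
    qed
  next
    case (step v)
    then have "v \<in> S" using sub by blast
    show ?case
    proof (cases "\<tau> v = y")
      case True
      then have "?\<pi> (?\<pi> v) = y" using app[OF \<open>v \<in> S\<close>] xy by simp
      then show ?thesis using True step.IH by (metis orbit.step)
    next
      case False
      then show ?thesis using app[OF \<open>v \<in> S\<close>] step.IH by (metis orbit.step)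
    qed
  qed
  have 2: "v \<in> (if y \<in> orbit \<tau> u then insert x (orbit \<tau> u) else orbit \<tau> u)" if "v \<in> orbit ?\<pi> u" for v
    using that
  proof induction
    case base
    have "\<tau> u \<in> orbit \<tau> u" by (rule orbit.base)
    then show ?case using app[OF assms(5)] by auto
  next
    case (step v)
    show ?case
    proof (cases "v = x")
      case True
      then show ?thesis using step.IH xy sub assms(3) by (auto split: if_splits)
    next
      case False
      then have "v \<in> orbit \<tau> u" using step.IH by (auto split: if_splits)
      then have "v \<in> S" "\<tau> v \<in> orbit \<tau> u" using sub by (auto intro: orbit.step)
      then show ?thesis using app[OF \<open>v \<in> S\<close>] by auto
    qed
  qed
  have 3: "x \<in> orbit ?\<pi> u" if "y \<in> orbit \<tau> u"
  proof -
    have "y \<in> orbit ?\<pi> u" using 1[OF that] .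
    moreover have "x \<in> orbit ?\<pi> y"
    proof -
      have "y \<in> orbit ?\<pi> x" by (metis xy orbit.base)
      then show ?thesis using orbit_eq_iff[OF \<pi>, of y x] self_in_orbit[OF \<pi>] assms(2) by blast
    qed
    ultimately show ?thesis by (rule orbit_trans[rotated])
  qed
  show ?thesis
  proof (rule set_eqI)
    fix v
    show "v \<in> orbit ?\<pi> u \<longleftrightarrow> v \<in> (if y \<in> orbit \<tau> u then insert x (orbit \<tau> u) else orbit \<tau> u)"
      using 1[of v] 2[of v] 3 by (auto split: if_splits)
  qed
qed

lemma cycles_transpose_comp:
  assumes "\<tau> permutes S" "finite S" "x \<notin> S" "y \<in> S"
  shows "cycles (insert x S) (transpose x y \<circ> \<tau>) = (\<lambda>C. if y \<in> C then insert x C else C) ` cycles S \<tau>"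
proof -
  let ?\<pi> = "transpose x y \<circ> \<tau>"
  have \<pi>: "?\<pi> permutes insert x S"
    using assms(1,4) by (intro transpose_comp_permutes) auto
  have "?\<pi> x = y" using permutes_not_in[OF assms(1,3)] by simp
  then have "y \<in> orbit ?\<pi> x" by (metis orbit.base)
  then have "orbit ?\<pi> x = orbit ?\<pi> y" using orbit_eq_iff[OF \<pi>, of y x] assms(2) by simp
  then have "cycles (insert x S) ?\<pi> = orbit ?\<pi> ` S" using assms(4) by (auto simp: cycles_def)
  also have "\<dots> = (\<lambda>C. if y \<in> C then insert x C else C) ` cycles S \<tau>"
    unfolding cycles_def image_image
    by (rule image_cong[OF refl]) (rule orbit_transpose_comp[OF assms])
  finally show ?thesis .
qed

text \<open>No old cycle contains \<open>x\<close>, so erasing \<open>x\<close> undoes the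
  insertion. Hence insertion preserves the number of cycles.\<close>

lemma inj_on_insert_cycles:
  assumes "\<tau> permutes S" "x \<notin> S"
  shows "inj_on (\<lambda>C. if y \<in> C then insert x C else C) (cycles S \<tau>)"
proof (rule inj_onI)
  fix C D assume "C \<in> cycles S \<tau>" "D \<in> cycles S \<tau>"
  then have "x \<notin> C" "x \<notin> D" using cycles_subset[OF assms(1)] assms(2) by blast+
  then show "(if y \<in> C then insert x C else C) = (if y \<in> D then insert x D else D) \<Longrightarrow> C = D"
    by (auto split: if_splits)
qed

definition odd_cycles :: "'a set \<Rightarrow> ('a \<Rightarrow> 'a) set" where
  "odd_cycles S = {\<pi>. \<pi> permutes S \<and> (\<forall>C\<in>cycles S \<pi>. odd (card C))}"

text \<open>Removing a point from a cycle of length at least \<open>2\<close> changes the parity of that cycle only.\<close>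

definition odd_cycles_except :: "'a set \<Rightarrow> 'a \<Rightarrow> ('a \<Rightarrow> 'a) set" where
  "odd_cycles_except S a = {\<pi>. \<pi> permutes S \<and> (\<forall>C\<in>cycles S \<pi>. odd (card C) \<longleftrightarrow> a \<notin> C)}"

lemma card_cycles_transpose_comp:
  assumes "\<tau> permutes S" "finite S" "x \<notin> S" "y \<in> S"
  shows "card (cycles (insert x S) (transpose x y \<circ> \<tau>)) = card (cycles S \<tau>)"
  unfolding cycles_transpose_comp[OF assms] by (rule card_image[OF inj_on_insert_cycles[OF assms(1,3)]])

text \<open>Only the cycle of \<open>y\<close> grows. It must have been even for all cycles to
  become odd; if all cycles were odd, the one through \<open>x\<close> becomes the only even
  one.\<close>

lemma transpose_comp_in_odd_cycles:
  assumes "\<tau> permutes S" "finite S" "x \<notin> S" "y \<in> S"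
  shows "transpose x y \<circ> \<tau> \<in> odd_cycles (insert x S) \<longleftrightarrow> \<tau> \<in> odd_cycles_except S y"
    and "transpose x y \<circ> \<tau> \<in> odd_cycles_except (insert x S) x \<longleftrightarrow> \<tau> \<in> odd_cycles S"
proof -
  have *: "finite C" "x \<notin> C" if "C \<in> cycles S \<tau>" for C
    using cycles_subset[OF assms(1) that] assms(2,3) finite_subset by auto
  define f where "f = (\<lambda>C. if y \<in> C then insert x C else C)"
  have cycles: "cycles (insert x S) (transpose x y \<circ> \<tau>) = f ` cycles S \<tau>"
    unfolding f_def by (rule cycles_transpose_comp[OF assms])
  have first: "odd (card (f C)) \<longleftrightarrow> (odd (card C) \<longleftrightarrow> y \<notin> C)"
    and second: "(odd (card (f C)) \<longleftrightarrow> x \<notin> f C) \<longleftrightarrow> odd (card C)" if "C \<in> cycles S \<tau>" for C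
    using *[OF that] by (auto simp: f_def)
  show "transpose x y \<circ> \<tau> \<in> odd_cycles (insert x S) \<longleftrightarrow> \<tau> \<in> odd_cycles_except S y"
    using assms(1,4) transpose_comp_permutes[of \<tau> S y x] first
    by (simp add: odd_cycles_def odd_cycles_except_def cycles)
  show "transpose x y \<circ> \<tau> \<in> odd_cycles_except (insert x S) x \<longleftrightarrow> \<tau> \<in> odd_cycles S"
    using assms(1,4) transpose_comp_permutes[of \<tau> S y x] second
    by (simp add: odd_cycles_def odd_cycles_except_def cycles)
qed

lemma cycles_insert_fixed:
  assumes "\<tau> permutes S" "finite S" "x \<notin> S"
  shows "cycles (insert x S) \<tau> = insert {x} (cycles S \<tau>)"
proof -
  have "\<tau> x = x" using permutes_not_in[OF assms(1,3)] .
  then have "orbit \<tau> x = {x}" by (simp add: orbit_eq_singleton_iff)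
  then show ?thesis by (simp add: cycles_def)
qed

text \<open>The case of a fixed \<open>x\<close> is split off because it adds a cycle instead of
  lengthening one.\<close>

lemma permutes_insert_cases:
  assumes "x \<notin> S"
  shows "{p. p permutes insert x S} = {p. p permutes S} \<union>
    (\<lambda>(y, p). transpose x y \<circ> p) ` (S \<times> {p. p permutes S})"
proof -
  let ?f = "\<lambda>(y, p). transpose x y \<circ> p" and ?P = "{p. p permutes S}"
  have "{(b, p). b \<in> insert x S \<and> p \<in> ?P} = {x} \<times> ?P \<union> S \<times> ?P" by auto
  moreover have "?f ` ({x} \<times> ?P) = ?P" by (force simp: image_iff)
  ultimately show ?thesis unfolding permutes_insert by (simp only: image_Un)
qed

lemma inj_on_transpose_comp:
  assumes "x \<notin> S"
  shows "inj_on (\<lambda>(y, p). transpose x y \<circ> p) (S \<times> {p. p permutes S})"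
proof (rule inj_onI, clarsimp)
  fix y z p q assume *: "p permutes S" "q permutes S" "transpose x y \<circ> p = transpose x z \<circ> q"
  have "(transpose x y \<circ> p) x = (transpose x z \<circ> q) x" using *(3) by simp
  then have "y = z" using permutes_not_in[OF *(1) assms] permutes_not_in[OF *(2) assms] by simp
  then have "transpose x y \<circ> (transpose x y \<circ> p) = transpose x y \<circ> (transpose x y \<circ> q)" using *(3) by simp
  then show "y = z \<and> p = q" using \<open>y = z\<close> by (simp add: o_assoc)
qed

section \<open>Recurrence for permutations with odd cycles, weighted by their number of
  cycles\<close>

definition odd_cycle_weight :: "'b::comm_semiring_1 \<Rightarrow> 'a set \<Rightarrow> 'b" where
  "odd_cycle_weight z S = (\<Sum>\<pi>\<in>odd_cycles S. z ^ card (cycles S \<pi>))"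

lemma finite_odd_cycles: "finite S \<Longrightarrow> finite (odd_cycles S)" "finite S \<Longrightarrow> finite (odd_cycles_except S a)"
  unfolding odd_cycles_def odd_cycles_except_def by (simp_all add: finite_permutations)

text \<open>A fixed \<open>x\<close> would form an odd cycle, so \<open>x\<close> was inserted
  before some \<open>y\<close> in \<open>S\<close> into a permutation with odd cycles only. The
  choice of \<open>y\<close> is free, and the number of cycles does not change.\<close>

lemma odd_cycles_except_weight:
  assumes "finite S" "x \<notin> S"
  shows "(\<Sum>\<pi>\<in>odd_cycles_except (insert x S) x. z ^ card (cycles (insert x S) \<pi>)) =
    of_nat (card S) * odd_cycle_weight (z :: 'b::comm_semiring_1) S"
proof -
  let ?f = "\<lambda>(y, p). transpose x y \<circ> p"
  have "odd_cycles_except (insert x S) x = ?f ` (S \<times> odd_cycles S)"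
  proof (intro equalityI subsetI)
    fix \<pi> assume \<pi>: "\<pi> \<in> odd_cycles_except (insert x S) x"
    then have "\<pi> \<in> {p. p permutes insert x S}" by (simp add: odd_cycles_except_def)
    then consider "\<pi> permutes S" | y \<tau> where "y \<in> S" "\<tau> permutes S" "\<pi> = transpose x y \<circ> \<tau>"
      unfolding permutes_insert_cases[OF assms(2)] by auto
    then show "\<pi> \<in> ?f ` (S \<times> odd_cycles S)"
    proof cases
      case 1
      then have "{x} \<in> cycles (insert x S) \<pi>" using cycles_insert_fixed[OF 1 assms] by simp
      then show ?thesis using \<pi> by (auto simp: odd_cycles_except_def)
    next
      case 2
      then show ?thesis using \<pi> transpose_comp_in_odd_cycles(2)[OF 2(2) assms 2(1)] by auto
    qed
  next
    fix \<pi> assume "\<pi> \<in> ?f ` (S \<times> odd_cycles S)"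
    then obtain y \<tau> where *: "y \<in> S" "\<tau> \<in> odd_cycles S" "\<pi> = transpose x y \<circ> \<tau>" by auto
    then have "\<tau> permutes S" by (simp add: odd_cycles_def)
    then show "\<pi> \<in> odd_cycles_except (insert x S) x"
      using transpose_comp_in_odd_cycles(2)[OF _ assms *(1)] * by blast
  qed
  moreover have "inj_on ?f (S \<times> odd_cycles S)"
    by (rule inj_on_subset[OF inj_on_transpose_comp[OF assms(2)]]) (auto simp: odd_cycles_def)
  ultimately have "(\<Sum>\<pi>\<in>odd_cycles_except (insert x S) x. z ^ card (cycles (insert x S) \<pi>)) =
      (\<Sum>q\<in>S \<times> odd_cycles S. z ^ card (cycles (insert x S) (?f q)))"
    by (simp add: sum.reindex)
  also have "\<dots> = (\<Sum>(y, \<tau>)\<in>S \<times> odd_cycles S. z ^ card (cycles S \<tau>))"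
    by (rule sum.cong) (auto simp: odd_cycles_def card_cycles_transpose_comp assms)
  also have "\<dots> = of_nat (card S) * odd_cycle_weight z S"
    by (simp add: odd_cycle_weight_def flip: sum.cartesian_product)
  finally show ?thesis .
qed

text \<open>Either \<open>x\<close> is fixed and forms a new cycle of weight \<open>z\<close>, or it
  was inserted before some \<open>y\<close> whose cycle was the only even one.\<close>

lemma odd_cycle_weight_insert:
  assumes "finite S" "x \<notin> S"
  shows "odd_cycle_weight (z :: 'b::comm_semiring_1) (insert x S) = z * odd_cycle_weight z S +
    (\<Sum>y\<in>S. \<Sum>\<tau>\<in>odd_cycles_except S y. z ^ card (cycles S \<tau>))"
proof -
  let ?f = "\<lambda>(y, p). transpose x y \<circ> p"
  let ?T = "Sigma S (odd_cycles_except S)"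
  have fixed: "\<pi> \<in> odd_cycles (insert x S) \<longleftrightarrow> \<pi> \<in> odd_cycles S" if "\<pi> permutes S" for \<pi>
    using that cycles_insert_fixed[OF that assms] permutes_imp_permutes_insert[OF that]
    by (auto simp: odd_cycles_def)
  have "odd_cycles (insert x S) = odd_cycles S \<union> ?f ` ?T"
  proof (intro equalityI subsetI)
    fix \<pi> assume \<pi>: "\<pi> \<in> odd_cycles (insert x S)"
    then have "\<pi> \<in> {p. p permutes insert x S}" by (simp add: odd_cycles_def)
    then consider "\<pi> permutes S" | y \<tau> where "y \<in> S" "\<tau> permutes S" "\<pi> = transpose x y \<circ> \<tau>"
      unfolding permutes_insert_cases[OF assms(2)] by auto
    then show "\<pi> \<in> odd_cycles S \<union> ?f ` ?T"
    proof cases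
      case 1
      then show ?thesis using fixed \<pi> by blast
    next
      case 2
      then show ?thesis using \<pi> transpose_comp_in_odd_cycles(1)[OF 2(2) assms 2(1)] by auto
    qed
  next
    fix \<pi> assume "\<pi> \<in> odd_cycles S \<union> ?f ` ?T"
    then consider "\<pi> \<in> odd_cycles S" | y \<tau> where "y \<in> S" "\<tau> \<in> odd_cycles_except S y" "\<pi> = transpose x y \<circ> \<tau>"
      by auto
    then show "\<pi> \<in> odd_cycles (insert x S)"
    proof cases
      case 1
      then show ?thesis using fixed by (auto simp: odd_cycles_def)
    next
      case 2
      then have "\<tau> permutes S" by (simp add: odd_cycles_except_def)
      then show ?thesis using transpose_comp_in_odd_cycles(1)[OF _ assms 2(1)] 2 by blast
    qed
  qed
  moreover have "odd_cycles S \<inter> ?f ` ?T = {}"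
  proof -
    have "(transpose x y \<circ> \<tau>) x = y" if "\<tau> permutes S" for y \<tau>
      using permutes_not_in[OF that assms(2)] by simp
    moreover have "\<pi> x = x" if "\<pi> \<in> odd_cycles S" for \<pi>
      using that permutes_not_in[OF _ assms(2)] by (auto simp: odd_cycles_def)
    ultimately show ?thesis using assms(2) unfolding odd_cycles_except_def by fastforce
  qed
  moreover have "inj_on ?f ?T"
    by (rule inj_on_subset[OF inj_on_transpose_comp[OF assms(2)]]) (auto simp: odd_cycles_except_def)
  ultimately have "odd_cycle_weight z (insert x S) = (\<Sum>\<pi>\<in>odd_cycles S. z ^ card (cycles (insert x S) \<pi>)) +
      (\<Sum>q\<in>?T. z ^ card (cycles (insert x S) (?f q)))"
    using assms(1) by (simp add: odd_cycle_weight_def sum.union_disjoint finite_odd_cycles sum.reindex)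
  also have "(\<Sum>q\<in>?T. z ^ card (cycles (insert x S) (?f q))) = (\<Sum>(y, \<tau>)\<in>?T. z ^ card (cycles S \<tau>))"
    by (rule sum.cong) (auto simp: odd_cycles_except_def card_cycles_transpose_comp assms)
  also have "\<dots> = (\<Sum>y\<in>S. \<Sum>\<tau>\<in>odd_cycles_except S y. z ^ card (cycles S \<tau>))"
    using assms(1) by (simp add: sum.Sigma finite_odd_cycles)
  also have "(\<Sum>\<pi>\<in>odd_cycles S. z ^ card (cycles (insert x S) \<pi>)) = z * odd_cycle_weight z S"
    unfolding odd_cycle_weight_def sum_distrib_left
  proof (rule sum.cong[OF refl])
    fix \<pi> assume "\<pi> \<in> odd_cycles S"
    then have "\<pi> permutes S" by (simp add: odd_cycles_def)
    moreover from this have "{x} \<notin> cycles S \<pi>" using cycles_subset assms(2) by blast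
    ultimately show "z ^ card (cycles (insert x S) \<pi>) = z * z ^ card (cycles S \<pi>)"
      using assms by (simp add: cycles_insert_fixed finite_cycles)
  qed
  finally show ?thesis .
qed

lemma odd_cycle_weight_empty: "odd_cycle_weight z ({} :: 'a set) = 1"
proof -
  have "odd_cycles ({} :: 'a set) = {id}" by (auto simp: odd_cycles_def cycles_def)
  then show ?thesis by (simp add: odd_cycle_weight_def cycles_def)
qed

text \<open>These are the coefficients of the differential equation
  \<open>(1 - x^2) G' = 2 m G\<close>, rewritten as \<open>G' = 2 m G + x^2 G'\<close>.\<close>

lemma fps_odd_cycle_recurrence:
  fixes G :: "rat fps" and m :: nat
  defines "G \<equiv> ((1 + fps_X) / (1 - fps_X)) ^ m"
  shows "of_nat (Suc n) * fps_nth G (Suc n) = 2 * of_nat m * fps_nth G n +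
    (if n = 0 then 0 else of_nat (n - 1) * fps_nth G (n - 1))"
proof -
  define q :: "rat fps" where "q = (1 + fps_X) / (1 - fps_X)"
  have q: "q * (1 - fps_X) = 1 + fps_X" unfolding q_def
    using inverse_mult_eq_1[of "1 - fps_X :: rat fps"] by (simp add: fps_divide_unit mult.assoc)
  then have "fps_deriv (q * (1 - fps_X)) = fps_deriv (1 + fps_X)" by simp
  then have "fps_deriv q * (1 - fps_X) = 1 + q" by (simp add: algebra_simps)
  then have "fps_deriv q * (1 - fps_X) * (1 + fps_X) = (1 + q) * (1 + fps_X)" by (rule arg_cong)
  \<comment> \<open>The summand \<open>1 + fps_X\<close> equals \<open>q * (1 - fps_X)\<close>,
    which leaves \<open>q\<close> times \<open>(1 - fps_X) + (1 + fps_X)\<close>.\<close>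
  also have "\<dots> = 2 * q" using q by algebra
  finally have dq: "fps_deriv q * (1 - fps_X) * (1 + fps_X) = 2 * q" .
  have "fps_deriv G * (1 - fps_X) * (1 + fps_X) = 2 * of_nat m * G"
  proof (cases m)
    case 0 then show ?thesis by (simp add: G_def)
  next
    case (Suc k)
    have "fps_deriv G = of_nat m * q ^ k * fps_deriv q"
      unfolding G_def q_def[symmetric] fps_deriv_power' Suc by (simp add: mult_ac)
    then have "fps_deriv G * (1 - fps_X) * (1 + fps_X) = of_nat m * q ^ k * (fps_deriv q * (1 - fps_X) * (1 + fps_X))"
      by (simp only: mult_ac)
    also have "\<dots> = 2 * of_nat m * G" unfolding dq G_def q_def[symmetric] Suc by (simp add: mult_ac)
    finally show ?thesis .
  qed
  then have "fps_deriv G = fps_const (2 * of_nat m) * G + fps_X * (fps_X * fps_deriv G)"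
    by (simp add: algebra_simps numeral_fps_const fps_of_nat flip: fps_const_mult)
  then have "fps_nth (fps_deriv G) n = fps_nth (fps_const (2 * of_nat m) * G + fps_X * (fps_X * fps_deriv G)) n"
    by (rule arg_cong)
  then show ?thesis by (cases n; cases "n - 1") (auto simp del: of_nat_Suc)
qed

text \<open>Removing \<open>x\<close> and, unless it is fixed, also its image \<open>y\<close> gives
  \<open>w(N + 1) = 2 m w(N) + N (N - 1) w(N - 1)\<close> for the weights \<open>w\<close>, with
  \<open>N = card S'\<close>. Division by \<open>N!\<close> turns this into the recurrence of the
  coefficients.\<close>

lemma odd_cycle_weight_eq:
  assumes "finite S"
  shows "odd_cycle_weight (2 * of_nat m) S = fact (card S) * fps_nth (((1 + fps_X) / (1 - fps_X) :: rat fps) ^ m) (card S)"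
  using assms
proof (induction "card S" arbitrary: S rule: less_induct)
  case less
  define G :: "rat fps" where "G = ((1 + fps_X) / (1 - fps_X)) ^ m"
  show ?case
  proof (cases "S = {}")
    case True
    then show ?thesis by (simp add: odd_cycle_weight_empty fps_nth_power_0)
  next
    case False
    then obtain x S' where S: "S = insert x S'" "x \<notin> S'" by (meson Set.set_insert ex_in_conv)
    then have fin: "finite S'" and cS: "card S = Suc (card S')" using less.prems by auto
    have except: "(\<Sum>\<tau>\<in>odd_cycles_except S' y. (2 * of_nat m :: rat) ^ card (cycles S' \<tau>)) =
        of_nat (card S' - 1) * (fact (card S' - 1) * fps_nth G (card S' - 1))" if "y \<in> S'" for y
    proof -
      define T where "T = S' - {y}"
      have T: "S' = insert y T" "y \<notin> T" "finite T" using that fin by (auto simp: T_def)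
      then have "card T = card S' - 1" "card T < card S" using cS by auto
      then show ?thesis
        using odd_cycles_except_weight[OF T(3,2), of "2 * of_nat m :: rat"] less.hyps[of T] T
        by (simp add: G_def)
    qed
    have "odd_cycle_weight (2 * of_nat m) S = 2 * of_nat m * (fact (card S') * fps_nth G (card S')) +
        of_nat (card S') * (of_nat (card S' - 1) * (fact (card S' - 1) * fps_nth G (card S' - 1)))"
      unfolding S(1) odd_cycle_weight_insert[OF fin S(2)] using except less.hyps[of S'] fin cS
      by (simp add: G_def)
    also have "\<dots> = fact (card S') * (2 * of_nat m * fps_nth G (card S') +
        (if card S' = 0 then 0 else of_nat (card S' - 1) * fps_nth G (card S' - 1)))"
      by (cases "card S'") (simp_all add: algebra_simps)
    also have "\<dots> = fact (card S) * fps_nth G (card S)"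
      using fps_odd_cycle_recurrence[of "card S'" m, folded G_def] unfolding cS
      by (metis (no_types, lifting) fact_Suc mult.assoc mult.commute)
    finally show ?thesis unfolding G_def .
  qed
qed

lemma sum_d_odd:
  "(\<Sum>k=0..n. z ^ k * of_nat (d_odd n k)) = odd_cycle_weight z {1..n}"
proof -
  have le: "card (cycles {1..n} \<pi>) \<le> n" for \<pi>
    unfolding cycles_def using card_image_le[of "{1..n}" "orbit \<pi>"] by simp
  have d: "d_odd n k = card {\<pi> \<in> odd_cycles {1..n}. card (cycles {1..n} \<pi>) = k}" for k
    unfolding d_odd_def odd_cycles_def cycles_def by (rule arg_cong[where f = card]) blast
  have "odd_cycle_weight z {1..n} =
      (\<Sum>k\<in>{0..n}. \<Sum>\<pi>\<in>{\<pi> \<in> odd_cycles {1..n}. card (cycles {1..n} \<pi>) = k}. z ^ card (cycles {1..n} \<pi>))"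
    unfolding odd_cycle_weight_def
    by (rule sum.group[symmetric]) (use le in \<open>auto simp: finite_odd_cycles\<close>)
  also have "\<dots> = (\<Sum>k=0..n. z ^ k * of_nat (d_odd n k))"
    unfolding d by (rule sum.cong) (auto simp: mult.commute)
  finally show ?thesis by simp
qed

section \<open>Eulerian generating functions\<close>

text \<open>With all letters positive these are ordinary \<open>P\<close>-partitions, weakly
  increasing at ascents and strictly at descents: each further position contributes
  \<open>1 / (1 - fps_X)\<close>, and each descent another \<open>fps_X\<close>.\<close>

lemma unsigned_enriched_gf:
  assumes "n \<ge> 1"
  shows "Abs_fps (\<lambda>v. of_nat (card (enriched (\<lambda>_. True) S n 0 v))) * (1 - fps_X) ^ (n + 1) =
    (fps_X :: 'a::comm_ring_1 fps) ^ (card ({1..<n} - S) + 1)"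
  using assms
proof (induction n rule: dec_induct)
  case base
  have "Abs_fps (\<lambda>v. of_nat (card (enriched (\<lambda>_. True) S 1 0 v))) = (Abs_fps (\<lambda>i. of_nat (1 * i + 0)) :: 'a fps)"
    unfolding card_enriched_1 by simp
  then show ?case using arithmetic_1_minus_X[of 1 0, where ?'a = 'a] by (simp add: mult.commute power2_eq_square)
next
  case (step n)
  define G :: "nat \<Rightarrow> 'a fps"
    where "G = (\<lambda>n. Abs_fps (\<lambda>v. of_nat (card (enriched (\<lambda>_. True) S n 0 v))))"
  have "G (Suc n) = fps_X * G (Suc n) + (if n \<in> S then G n else fps_X * G n)"
  proof (rule fps_ext)
    fix v
    show "fps_nth (G (Suc n)) v = fps_nth (fps_X * G (Suc n) + (if n \<in> S then G n else fps_X * G n)) v"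
    proof (cases v)
      case 0
      then show ?thesis using step.hyps by (simp add: G_def card_enriched_0)
    next
      case (Suc u)
      then show ?thesis using card_enriched_Suc[OF step.hyps(1), of 0 "\<lambda>_. True" S u] by (simp add: G_def)
    qed
  qed
  then have "G (Suc n) * (1 - fps_X) = (if n \<in> S then G n else fps_X * G n)"
    by (simp add: algebra_simps)
  then have "G (Suc n) * (1 - fps_X) ^ (Suc n + 1) = (if n \<in> S then G n else fps_X * G n) * (1 - fps_X) ^ (n + 1)"
    by (simp flip: mult.assoc)
  also have "\<dots> = (if n \<in> S then 1 else fps_X) * (G n * (1 - fps_X) ^ (n + 1))"
    by (simp add: mult.assoc)
  also have "\<dots> = fps_X ^ ((if n \<in> S then 0 else 1) + (card ({1..<n} - S) + 1))"
    using step.IH by (simp add: G_def)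
  also have "(if n \<in> S then 0 else 1) + (card ({1..<n} - S) + 1) = card ({1..<Suc n} - S) + 1"
  proof -
    have "{1..<Suc n} - S = (if n \<in> S then {} else {n}) \<union> ({1..<n} - S)"
      using step.hyps by (auto simp: less_Suc_eq)
    then show ?thesis by simp
  qed
  finally show ?case by (simp only: G_def)
qed

lemma des_eq_card_ascents:
  assumes "\<pi> permutes {1..n}" "n \<ge> 1"
  shows "des n \<pi> = card ({1..<n} - ascents n \<pi>)"
proof -
  have "\<pi> i \<noteq> \<pi> (Suc i)" for i using permutes_inj[OF assms(1)] by (metis injD n_not_Suc_n)
  then have "{1..<n} - ascents n \<pi> = {i \<in> {1..n - 1}. \<pi> i > \<pi> (i + 1)}"
    using assms(2) by (auto simp: ascents_def not_less order.strict_iff_order)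
  then show ?thesis by (simp add: des_def)
qed

text \<open>By standardization with weight 1, the \<open>P\<close>-partitions of all permutations
  together correspond to the \<open>j ^ k\<close> words over \<open>j\<close> letters.\<close>

lemma eulerian_A_gf:
  "eulerian_A k fps_X = Abs_fps (\<lambda>j. of_nat (j ^ k)) * (1 - fps_X :: 'a::comm_ring_1 fps) ^ (k + 1)"
proof (cases "k = 0")
  case True
  then show ?thesis using geometric_1_minus_X[where ?'a = 'a] by (simp add: eulerian_A_def mult.commute)
next
  case False
  then have k: "k \<ge> 1" by simp
  let ?E = "\<lambda>\<pi> j. card (enriched (\<lambda>_. True) (ascents k \<pi>) k 0 j)"
  \<comment> \<open>Inversion permutes the summands, which removes the inverse present in
    \<open>standardization\<close>.\<close>
  have words: "(\<Sum>\<pi> | \<pi> permutes {1..k}. ?E \<pi> j) = j ^ k" for j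
    using standardization[where n = k and \<epsilon> = "\<lambda>_. True" and lo = 0 and hi = j and \<Phi> = "\<lambda>_. 1"]
      sum_permutations_inverse[of "\<lambda>\<pi>. ?E \<pi> j" "{1..k}"] by (simp add: card_PiE)
  have "eulerian_A k fps_X =
      (\<Sum>\<pi> | \<pi> permutes {1..k}. Abs_fps (\<lambda>v. of_nat (?E \<pi> v)) * (1 - fps_X :: 'a fps) ^ (k + 1))"
    using k unfolding unsigned_enriched_gf[OF k] eulerian_A_def
    by (simp add: des_eq_card_ascents)
  also have "\<dots> = (\<Sum>\<pi> | \<pi> permutes {1..k}. Abs_fps (\<lambda>v. of_nat (?E \<pi> v))) * (1 - fps_X) ^ (k + 1)"
    by (rule sum_distrib_right[symmetric])
  also have "(\<Sum>\<pi> | \<pi> permutes {1..k}. Abs_fps (\<lambda>v. of_nat (?E \<pi> v))) = Abs_fps (\<lambda>j. of_nat (j ^ k) :: 'a)"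
    by (rule fps_ext) (simp only: fps_sum_nth fps_nth_Abs_fps words flip: of_nat_sum)
  finally show ?thesis .
qed

section \<open>The three identities\<close>

text \<open>The coefficients need not form a field, and the inverse of a series is built from
  \<open>inverse\<close> of its constant coefficient; hence the second hypothesis.\<close>

lemma fps_inverse_uniqueI:
  fixes f g :: "'a::{comm_ring_1,inverse} fps"
  assumes "f * g = 1" "inverse (fps_nth f 0) = fps_nth g 0"
  shows "inverse f = g"
proof -
  have "fps_nth g 0 * fps_nth f 0 = 1" using arg_cong[OF assms(1), of "\<lambda>h. fps_nth h 0"] by (simp add: mult.commute)
  from fps_lr_inverse_unique_ring1(2)[OF assms(1) this] show ?thesis
    unfolding fps_inverse_def assms(2) .
qed

text \<open>A nonzero rational constant term makes the inner constant coefficient a unit, and then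
  the whole series.\<close>

lemma rat_fps_fps_divide_mult:
  fixes f g :: "rat fps fps"
  assumes "fps_nth (fps_nth g 0) 0 \<noteq> 0"
  shows "f / g * g = f"
proof -
  have g0: "fps_nth g 0 \<noteq> 0" using assms by auto
  have "inverse (fps_nth g 0) * fps_nth g 0 = 1" using assms by (rule inverse_mult_eq_1)
  then have "inverse g * g = 1"
    using fps_left_inverse'[of "inverse (fps_nth g 0)" g "inverse (fps_nth g 0)"]
    by (simp add: fps_inverse_def mult.commute)
  then show ?thesis by (simp add: fps_divide_unit[OF g0] mult.assoc)
qed

text \<open>The inverse of 2 is computed one variable at a time, each layer providing the constant
  coefficient for the next.\<close>

lemma one_half_fps: "1 / 2 = fps_const (fps_const (fps_const (1 / 2 :: rat)))"
proof -
  have 1: "inverse (2 :: rat fps) = fps_const (1 / 2)"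
    by (rule fps_inverse_unique) (simp add: numeral_fps_const)
  have 2: "inverse (2 :: rat fps fps) = fps_const (fps_const (1 / 2))"
    by (rule fps_inverse_uniqueI) (simp add: numeral_fps_const, simp add: 1)
  have 3: "inverse (2 :: rat fps fps fps) = fps_const (fps_const (fps_const (1 / 2)))"
    by (rule fps_inverse_uniqueI) (simp add: numeral_fps_const, simp add: 2)
  show ?thesis by (subst fps_divide_unit) (simp_all add: 3)
qed

section \<open>Assembling double series in \<open>s\<close> and \<open>t\<close>\<close>

lemma st_series_product:
  "fps_const (Abs_fps (\<lambda>i. of_nat (a i))) * Abs_fps (\<lambda>j. of_nat (b j)) = st_series (\<lambda>i j. of_nat (a i * b j))"
proof (intro fps_ext)
  fix i j
  show "fps_nth (fps_nth (fps_const (Abs_fps (\<lambda>i. of_nat (a i))) * Abs_fps (\<lambda>j. of_nat (b j))) j) i =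
    fps_nth (fps_nth (st_series (\<lambda>i j. of_nat (a i * b j))) j) i"
    by (simp add: st_series_def flip: fps_of_nat)
qed

lemma st_series_sum: "(\<Sum>x\<in>X. st_series (c x)) = st_series (\<lambda>i j. \<Sum>x\<in>X. c x i j)"
  by (intro fps_ext) (simp add: st_series_def fps_sum_nth)

lemma st_series_scale: "fps_const (fps_const r) * st_series c = st_series (\<lambda>i j. r * c i j)"
  by (intro fps_ext) (simp add: st_series_def)

lemma one_plus_s_var: "1 + s_var = fps_const (1 + fps_X)"
  and one_minus_s_var: "1 - s_var = fps_const (1 - fps_X)"
  by (simp_all flip: fps_const_add fps_const_sub)

lemma lhs_summand:
  assumes "\<pi> permutes {1..n}" "n \<ge> 1"
  shows "(1 + s_var) ^ n * (1 + t_var) ^ (n + 1) / ((1 - s_var) * (1 - t_var)) ^ (n + 1) *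
      ((4 * s_var / (1 + s_var)\<^sup>2) ^ lpk n \<pi> * (4 * t_var / (1 + t_var)\<^sup>2) ^ (ipk n \<pi> + 1)) =
    2 * st_series (\<lambda>i j. of_nat (card (enriched even (ascents n \<pi>) n 0 (2 * i + 1)) *
      card (enriched even (ascents n (inv \<pi>)) n 1 (2 * j + 1))))"
proof -
  define us ut ps pt :: "rat fps fps"
    where "us = 1 - s_var" and "ut = 1 - t_var" and "ps = 1 + s_var" and "pt = 1 + t_var"
  define F G :: "rat fps fps"
    where "F = fps_const (Abs_fps (\<lambda>i. of_nat (card (enriched even (ascents n \<pi>) n 0 (2 * i + 1)))))"
      and "G = Abs_fps (\<lambda>j. of_nat (card (enriched even (ascents n (inv \<pi>)) n 1 (2 * j + 1))))"
  define l k where "l = lpk n \<pi>" and "k = ipk n \<pi> + 1"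
  define Q zs zt :: "rat fps fps"
    where "Q = ps ^ n * pt ^ (n + 1) / (us * ut) ^ (n + 1)" and "zs = 4 * s_var / ps\<^sup>2" and "zt = 4 * t_var / pt\<^sup>2"
  have unit: "fps_nth (fps_nth us 0) 0 = 1" "fps_nth (fps_nth ut 0) 0 = 1"
    "fps_nth (fps_nth ps 0) 0 = 1" "fps_nth (fps_nth pt 0) 0 = 1"
    by (simp_all add: us_def ut_def ps_def pt_def)
  have Q: "Q * (us * ut) ^ (n + 1) = ps ^ n * pt ^ (n + 1)"
    unfolding Q_def by (rule rat_fps_fps_divide_mult) (simp add: fps_nth_power_0 unit)
  have "zs * ps\<^sup>2 = 4 * s_var" "zt * pt\<^sup>2 = 4 * t_var"
    unfolding zs_def zt_def by (rule rat_fps_fps_divide_mult; simp add: fps_nth_power_0 unit)+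
  then have z: "zs ^ l * ps ^ (2 * l) = (4 * s_var) ^ l" "zt ^ k * pt ^ (2 * k) = (4 * t_var) ^ k"
    by (simp_all only: power_mult flip: power_mult_distrib)
  \<comment> \<open>The identity in \<open>s\<close> holds among the coefficients and is lifted by
    \<open>fps_const\<close>. The one in \<open>t\<close> is taken over \<open>rat fps\<close> and
    for the inverse permutation, since \<open>ipk\<close> is the peak number of the inverse.\<close>
  have F: "F * us ^ (n + 1) * ps ^ (2 * l) = ps ^ n * (4 * s_var) ^ l"
    unfolding F_def us_def ps_def l_def one_plus_s_var one_minus_s_var numeral_fps_const[where ?'a = "rat fps"]
      fps_const_mult fps_const_power
    using left_enriched_gf[OF assms, where ?'a = rat] by (rule arg_cong)
  have G: "2 * G * ut ^ (n + 1) * pt ^ (2 * k) = pt ^ (n + 1) * (4 * t_var) ^ k"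
    using enriched_gf[OF permutes_inv[OF assms(1)] assms(2), where ?'a = "rat fps"]
    unfolding G_def ut_def pt_def k_def ipk_def .
  \<comment> \<open>Both sides are compared after multiplication by the denominators, which are
    nonzero and cancel in this domain.\<close>
  have "Q * (zs ^ l * zt ^ k) * ((us * ut) ^ (n + 1) * ps ^ (2 * l) * pt ^ (2 * k)) =
      (Q * (us * ut) ^ (n + 1)) * (zs ^ l * ps ^ (2 * l)) * (zt ^ k * pt ^ (2 * k))"
    by (simp only: mult_ac)
  also have "\<dots> = (ps ^ n * (4 * s_var) ^ l) * (pt ^ (n + 1) * (4 * t_var) ^ k)"
    unfolding Q z by (simp only: mult_ac)
  also have "\<dots> = 2 * (F * G) * ((us * ut) ^ (n + 1) * ps ^ (2 * l) * pt ^ (2 * k))"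
    unfolding F[symmetric] G[symmetric] by (simp only: power_mult_distrib mult_ac)
  finally have "Q * (zs ^ l * zt ^ k) * ((us * ut) ^ (n + 1) * ps ^ (2 * l) * pt ^ (2 * k)) =
    2 * (F * G) * ((us * ut) ^ (n + 1) * ps ^ (2 * l) * pt ^ (2 * k))" .
  moreover have "us \<noteq> 0" "ut \<noteq> 0" "ps \<noteq> 0" "pt \<noteq> 0" using unit by auto
  ultimately have "Q * (zs ^ l * zt ^ k) = 2 * (F * G)" by simp
  then show ?thesis
    unfolding F_def G_def st_series_product Q_def zs_def zt_def us_def ut_def ps_def pt_def l_def k_def .
qed

lemma lhs_term_eq:
  assumes "n \<ge> 1"
  shows "lhs_term n = 2 * st_series (\<lambda>i j. fps_nth (((1 + fps_X) / (1 - fps_X)) ^ (2 * i * j + j)) n)"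
proof -
  have "lhs_term n = (\<Sum>\<pi> | \<pi> permutes {1..n}.
      2 * st_series (\<lambda>i j. of_nat (card (enriched even (ascents n \<pi>) n 0 (2 * i + 1)) *
        card (enriched even (ascents n (inv \<pi>)) n 1 (2 * j + 1)))))"
    unfolding lhs_term_def P_lpk_ipk_def sum_distrib_left
    by (rule sum.cong[OF refl]) (use lhs_summand[OF _ assms] in simp)
  then show ?thesis
    unfolding sum_distrib_left[symmetric] st_series_sum sum_enriched_pairs[OF assms] .
qed

text \<open>The Cauchy product of the binomial series of \<open>(1 + x)^m\<close> and the negative
  binomial series of \<open>(1 - x)^(-m)\<close>.\<close>

lemma fps_nth_quotient_power:
  "fps_nth (((1 + fps_X) / (1 - fps_X) :: rat fps) ^ m) n =
    (\<Sum>k=0..n. of_nat ((m choose k) * ((m + n - k - 1) choose (n - k))))"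
proof (cases "m = 0")
  case True
  \<comment> \<open>For \<open>m = 0\<close> only \<open>k = 0\<close> survives. With truncated
    subtraction, \<open>(n - 1) choose n\<close> is 1 at \<open>n = 0\<close> and 0 otherwise, as
    required.\<close>
  have "(\<Sum>k=0..n. of_nat ((0 choose k) * ((n - k - 1) choose (n - k)))) = (\<Sum>k\<in>{0}. of_nat ((n - 1) choose n) :: rat)"
    by (subst sum.atLeast_Suc_atMost) (auto intro!: sum.neutral simp: binomial_eq_0)
  then show ?thesis using True by (cases n) auto
next
  case False
  have "((1 + fps_X) / (1 - fps_X) :: rat fps) ^ m = (1 + fps_X) ^ m * inverse ((1 - fps_const 1 * fps_X) ^ m)"
    by (simp add: fps_divide_unit power_mult_distrib fps_inverse_power)
  also have "\<dots> = Abs_fps (\<lambda>k. of_nat (m choose k)) * Abs_fps (\<lambda>k. of_nat ((m + k - 1) choose k))"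
    using False by (simp only: one_minus_const_fps_X_neg_power' fps_binomial_of_nat[symmetric])
      (simp add: fps_binomial_def binomial_gbinomial)
  finally show ?thesis
    by (simp add: fps_mult_nth)
qed

text \<open>The two Eulerian generating functions have coefficients \<open>(2 * i + 1) ^ k\<close>
  and \<open>j ^ k\<close>, and \<open>(2 * i + 1) * j = 2 * i * j + j\<close>.\<close>

lemma eulerian_product_gf:
  "fps_const (fps_of_poly (eulerian_B k)) * eulerian_A k t_var / ((1 - s_var) ^ (k + 1) * (1 - t_var) ^ (k + 1)) =
    st_series (\<lambda>i j. of_nat ((2 * i * j + j) ^ k))"
proof -
  define W where "W = (1 - s_var) ^ (k + 1) * (1 - t_var) ^ (k + 1)"
  have B: "fps_of_poly (eulerian_B k) = Abs_fps (\<lambda>i. of_nat ((2 * i + 1) ^ k)) * (1 - fps_X) ^ (k + 1)"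
  proof -
    have "fps_of_poly (eulerian_B k) / (1 - fps_X) ^ (k + 1) * (1 - fps_X) ^ (k + 1) = fps_of_poly (eulerian_B k)"
      by (simp add: fps_divide_unit mult.assoc inverse_mult_eq_1 fps_nth_power_0 del: power_Suc)
    then show ?thesis unfolding eulerian_B_gf by (simp add: algebra_simps)
  qed
  have W0: "fps_nth (fps_nth W 0) 0 = 1" by (simp add: W_def fps_nth_power_0 del: power_Suc)
  have "fps_const (fps_of_poly (eulerian_B k)) * eulerian_A k t_var =
      fps_const (Abs_fps (\<lambda>i. of_nat ((2 * i + 1) ^ k))) * Abs_fps (\<lambda>j. of_nat (j ^ k)) * W"
    unfolding B eulerian_A_gf W_def one_minus_s_var
    by (simp only: mult_ac flip: fps_const_mult fps_const_power)
  also have "\<dots> = st_series (\<lambda>i j. of_nat ((2 * i * j + j) ^ k)) * W"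
    unfolding st_series_product by (simp add: algebra_simps flip: power_mult_distrib)
  finally have "fps_const (fps_of_poly (eulerian_B k)) * eulerian_A k t_var / W * W =
      st_series (\<lambda>i j. of_nat ((2 * i * j + j) ^ k)) * W"
    using rat_fps_fps_divide_mult[of W] W0 by simp
  moreover have "W \<noteq> 0" using W0 by auto
  ultimately show ?thesis unfolding W_def by simp
qed

text \<open>In each coefficient, with \<open>m = 2 * i * j + j\<close>, the powers combine to
  \<open>(2 * m) ^ k\<close>, so the sum is twice the odd-cycle weight at
  \<open>2 * m\<close>.\<close>

lemma odd_cycle_expansion:
  "(\<Sum>k=0..n. 2 ^ (k + 1) * of_nat (d_odd n k) *
      (fps_const (fps_of_poly (eulerian_B k)) * eulerian_A k t_var / ((1 - s_var) ^ (k + 1) * (1 - t_var) ^ (k + 1)))) =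
    fact n * (2 * st_series (\<lambda>i j. fps_nth (((1 + fps_X) / (1 - fps_X)) ^ (2 * i * j + j)) n))"
proof -
  have const: "(of_nat m :: rat fps fps) = fps_const (fps_const (of_nat m))" for m by (simp add: fps_of_nat)
  have coeff: "(\<Sum>k=0..n. of_nat (2 ^ (k + 1) * d_odd n k) * of_nat (m ^ k)) =
      of_nat (fact n * 2) * fps_nth (((1 + fps_X) / (1 - fps_X) :: rat fps) ^ m) n" for m
  proof -
    have "(\<Sum>k=0..n. of_nat (2 ^ (k + 1) * d_odd n k) * of_nat (m ^ k)) =
        2 * (\<Sum>k=0..n. (2 * of_nat m :: rat) ^ k * of_nat (d_odd n k))"
      by (simp add: sum_distrib_left power_mult_distrib mult_ac)
    also have "\<dots> = 2 * (fact n * fps_nth (((1 + fps_X) / (1 - fps_X) :: rat fps) ^ m) n)"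
      unfolding sum_d_odd by (simp add: odd_cycle_weight_eq)
    finally show ?thesis by simp
  qed
  have "(\<Sum>k=0..n. 2 ^ (k + 1) * of_nat (d_odd n k) *
      (fps_const (fps_of_poly (eulerian_B k)) * eulerian_A k t_var / ((1 - s_var) ^ (k + 1) * (1 - t_var) ^ (k + 1)))) =
      (\<Sum>k=0..n. of_nat (2 ^ (k + 1) * d_odd n k) * st_series (\<lambda>i j. of_nat ((2 * i * j + j) ^ k)))"
    unfolding eulerian_product_gf by simp
  also have "\<dots> = of_nat (fact n * 2) * st_series (\<lambda>i j. fps_nth (((1 + fps_X) / (1 - fps_X)) ^ (2 * i * j + j)) n)"
    unfolding const st_series_scale st_series_sum coeff ..
  finally show ?thesis by (simp add: mult.assoc)
qed

theorem theorem4p6: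
  shows
    "fps_const (1 / ((1 - s_var) * (1 - t_var)))
       + 1 / 2 * Abs_fps (\<lambda>n. if n = 0 then 0 else lhs_term n)
     = Abs_fps (\<lambda>n. st_series (\<lambda>i j. fps_nth (((1 + fps_X) / (1 - fps_X)) ^ (2 * i * j + j)) n))
   \<and> (\<forall>n\<ge>1. lhs_term n =
        2 * st_series (\<lambda>i j. \<Sum>k=0..n.
          of_nat (((2 * i * j + j) choose k) * ((2 * i * j + j + n - k - 1) choose (n - k)))))
   \<and> (\<forall>n\<ge>1. lhs_term n =
        1 / fact n * (\<Sum>k=0..n. 2 ^ (k + 1) * of_nat (d_odd n k) *
          (fps_const (fps_of_poly (eulerian_B k)) * eulerian_A k t_var /
            ((1 - s_var) ^ (k + 1) * (1 - t_var) ^ (k + 1)))))"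
proof (intro conjI allI impI)
  let ?R = "\<lambda>n. st_series (\<lambda>i j. fps_nth (((1 + fps_X) / (1 - fps_X)) ^ (2 * i * j + j)) n)"
  have half: "fps_const (fps_const (1 / 2)) * (2 :: rat fps fps) = 1" by (simp add: numeral_fps_const)
  show "fps_const (1 / ((1 - s_var) * (1 - t_var))) + 1 / 2 * Abs_fps (\<lambda>n. if n = 0 then 0 else lhs_term n) =
    Abs_fps ?R"
  proof (rule fps_ext)
    fix n
    show "fps_nth (fps_const (1 / ((1 - s_var) * (1 - t_var))) +
        1 / 2 * Abs_fps (\<lambda>n. if n = 0 then 0 else lhs_term n)) n = fps_nth (Abs_fps ?R) n"
    proof (cases "n = 0")
      case True
      \<comment> \<open>At \<open>x = 0\<close> every power of the quotient is 1, so the double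
        series with all coefficients 1 is required here.\<close>
      have "1 / ((1 - s_var) * (1 - t_var)) = st_series (\<lambda>i j. 1)" (is "1 / ?W = ?T")
      proof -
        have "?T = fps_const (Abs_fps (\<lambda>_. 1)) * Abs_fps (\<lambda>_. 1)"
          using st_series_product[of "\<lambda>_. 1" "\<lambda>_. 1"] by simp
        then have "?T * ?W = fps_const ((1 - fps_X) * Abs_fps (\<lambda>_. 1)) * ((1 - fps_X) * Abs_fps (\<lambda>_. 1))"
          unfolding one_minus_s_var by (simp only: mult_ac flip: fps_const_mult)
        then have "?T * ?W = 1" unfolding geometric_1_minus_X by simp
        moreover have "1 / ?W * ?W = 1" by (rule rat_fps_fps_divide_mult) simp
        moreover have "?W \<noteq> 0" using calculation(1) by auto
        ultimately show ?thesis by (metis mult_right_cancel)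
      qed
      then show ?thesis using True by (simp add: one_half_fps fps_nth_power_0)
    next
      case False
      then have "n \<ge> 1" by simp
      have "fps_const (fps_const (1 / 2)) * lhs_term n = ?R n"
        unfolding lhs_term_eq[OF \<open>n \<ge> 1\<close>] mult.assoc[symmetric] half by (rule mult_1)
      then show ?thesis using False by (simp add: one_half_fps)
    qed
  qed
next
  fix n :: nat assume "n \<ge> 1"
  then show "lhs_term n = 2 * st_series (\<lambda>i j. \<Sum>k=0..n.
      of_nat (((2 * i * j + j) choose k) * ((2 * i * j + j + n - k - 1) choose (n - k))))"
    by (simp only: lhs_term_eq fps_nth_quotient_power)
next
  fix n :: nat assume n: "n \<ge> 1"
  let ?S = "\<Sum>k=0..n. 2 ^ (k + 1) * of_nat (d_odd n k) *
    (fps_const (fps_of_poly (eulerian_B k)) * eulerian_A k t_var / ((1 - s_var) ^ (k + 1) * (1 - t_var) ^ (k + 1)))"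
  \<comment> \<open>The factorial is a nonzero rational constant, hence a unit of this ring.\<close>
  have unit: "1 / fact n * (fact n :: rat fps fps) = 1"
  proof (rule rat_fps_fps_divide_mult)
    have "(fact n :: rat fps fps) = of_nat (fact n)" by (rule of_nat_fact[symmetric])
    also have "\<dots> = fps_const (fps_const (of_nat (fact n)))" by (simp only: fps_of_nat)
    finally have "(fact n :: rat fps fps) = fps_const (fps_const (of_nat (fact n)))" .
    then show "fps_nth (fps_nth (fact n :: rat fps fps) 0) 0 \<noteq> 0" by simp
  qed
  have "?S = fact n * lhs_term n" unfolding lhs_term_eq[OF n] by (rule odd_cycle_expansion)
  then show "lhs_term n = 1 / fact n * ?S" by (simp only: mult.assoc[symmetric] unit mult_1)
qed

end
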